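(* Let $\mathcal{P}_p$ and $\mathcal{P}_q$ be two single-qubit Pauli channels with distortion matrices $\Lambda_p=\mathrm{diag}(c_{p1},c_{p2},c_{p3})$ and $\Lambda_q=\mathrm{diag}(c_{q1},c_{q2},c_{q3})$, respectively. Then $$d_{\mathrm{t}}^{K=1}(\mathcal{P}_p,\mathcal{P}_q)=\max_{i\in\{1,2,3\}}\sqrt{f\big(\overline{c}_i^{\,2}\big)-\tfrac12\big[f\big(c_{pi}^2\big)+f\big(c_{qi}^2\big)\big]},$$ where $\overline{c}_i=(c_{pi}+c_{qi})/2$, $f(x)=H_2\big(\tfrac{1-\sqrt{x}}{2}\big)$ for $x\in[0,1]$, and $H_2(x)=-x\log_2 x-(1-x)\log_2(1-x)$ for $x\in[0,1]$ is the binary entropy function.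
   Context: $\mathcal{M}_2$ denotes the set of $2\times 2$ density matrices. Let $\sigma_0$ be the $2\times 2$ identity matrix and $\sigma_1,\sigma_2,\sigma_3$ the Pauli matrices. For a probability vector $(p_\alpha)_{\alpha=0}^3$, the Pauli channel is $\mathcal{P}_p(\rho)=\sum_{\alpha=0}^3 p_\alpha\sigma_\alpha\rho\sigma_\alpha$. Writing a qubit state as $\rho=\frac12(\mathbb{1}+\boldsymbol{r}\cdot\boldsymbol{\sigma})$ with Bloch vector $\boldsymbol{r}\in\mathbb{R}^3$, $|\boldsymbol r|\le 1$, a Pauli channel acts by $\boldsymbol r\mapsto\Lambda\boldsymbol r$, where the distortion matrix is $\Lambda=\mathrm{diag}(c_1,c_2,c_3)$ with $c_1=p_0+p_1-p_2-p_3$, $c_2=p_0-p_1+p_2-p_3$, $c_3=p_0-p_1-p_2+p_3$. With von Neumann entropy $\mathrm{S}(\rho)=-\mathrm{Tr}[\rho\log_2\rho]$ (convention $0\log_2 0=0$), put $\mathrm{QJSD}(\rho,\sigma)=\mathrm{S}\big(\tfrac{\rho+\sigma}{2}\big)-\tfrac12\mathrm{S}(\rho)-\tfrac12\mathrm{S}(\sigma)$. The entropic channel divergence without ancilla is $$d_{\mathrm{t}}^{K=1}(\mathcal{E},\mathcal{F})=\sup_{\rho\in\mathcal{M}_2}\sqrt{\mathrm{QJSD}[\mathcal{E}(\rho),\mathcal{F}(\rho)]}.$$ *)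

theory Defs
  imports "HOL-Analysis.Analysis"
begin

section \<open>Complex matrices\<close>

definition cadjoint :: "complex^'n^'m \<Rightarrow> complex^'m^'n" where
  "cadjoint A = (\<chi> i j. cnj (A $ j $ i))"

definition unitary_matrix :: "complex^'n^'n \<Rightarrow> bool" where
  "unitary_matrix U \<longleftrightarrow> cadjoint U ** U = mat 1 \<and> U ** cadjoint U = mat 1"

definition hermitian_matrix :: "complex^'n^'n \<Rightarrow> bool" where
  "hermitian_matrix A \<longleftrightarrow> cadjoint A = A"

definition psd_matrix :: "complex^'n^'n \<Rightarrow> bool" where
  "psd_matrix A \<longleftrightarrow> hermitian_matrix A \<and>
     (\<forall>v. 0 \<le> Re (\<Sum>i\<in>UNIV. cnj (v $ i) * (A *v v) $ i))"

definition diag_matrix :: "'a::zero^'n \<Rightarrow> 'a^'n^'n" where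
  "diag_matrix d = (\<chi> i j. if i = j then d $ i else 0)"

definition density_matrices :: "(complex^'n^'n) set" where
  "density_matrices = {\<rho>. psd_matrix \<rho> \<and> trace \<rho> = 1}"


section \<open>Functional calculus and von Neumann entropy\<close>

definition spectral_apply ::
  "(real \<Rightarrow> real) \<Rightarrow> complex^'n^'n \<Rightarrow> complex^'n^'n \<Rightarrow> bool" where
  "spectral_apply g A B \<longleftrightarrow> (\<exists>U (d::real^'n). unitary_matrix U \<and>
     A = U ** diag_matrix (\<chi> i. of_real (d $ i)) ** cadjoint U \<and>
     B = U ** diag_matrix (\<chi> i. of_real (g (d $ i))) ** cadjoint U)"

text \<open>For Hermitian \<open>A\<close>, this is the matrix \<open>g(A)\<close>. It does not depend on the chosen
  diagonalisation; see \<open>herm_fun_eq\<close> below.\<close>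

definition herm_fun :: "(real \<Rightarrow> real) \<Rightarrow> complex^'n^'n \<Rightarrow> complex^'n^'n" where
  "herm_fun g A = (THE B. spectral_apply g A B)"

text \<open>For singular \<open>\<rho>\<close>, \<open>log 2 0\<close> is a real number whose value is immaterial, since it gets
  multiplied by the eigenvalue \<open>0\<close> of \<open>\<rho>\<close>: this is the convention \<open>0 log 0 = 0\<close>.
  The trace is real, and \<open>Re\<close> only changes its type.\<close>

definition vn_entropy :: "complex^'n^'n \<Rightarrow> real" where
  "vn_entropy \<rho> = - Re (trace (\<rho> ** herm_fun (log 2) \<rho>))"

definition QJSD :: "complex^'n^'n \<Rightarrow> complex^'n^'n \<Rightarrow> real" where
  "QJSD \<rho> \<sigma> = vn_entropy ((1/2) *\<^sub>R (\<rho> + \<sigma>)) - 1/2 * vn_entropy \<rho> - 1/2 * vn_entropy \<sigma>"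

text \<open>A supremum in \<open>real\<close>; for channels the set is bounded above, as the entropy of a qubit
  state lies in \<open>[0, 1]\<close>.\<close>

definition ent_div1 ::
  "(complex^2^2 \<Rightarrow> complex^2^2) \<Rightarrow> (complex^2^2 \<Rightarrow> complex^2^2) \<Rightarrow> real" where
  "ent_div1 \<E> \<F> = (SUP \<rho> \<in> density_matrices. sqrt (QJSD (\<E> \<rho>) (\<F> \<rho>)))"


section \<open>Pauli channels\<close>

text \<open>Only the indices \<open>0, \<dots>, 3\<close> are meaningful.\<close>

definition pauli :: "nat \<Rightarrow> complex^2^2" where
  "pauli \<alpha> =
    [vector [vector [1, 0], vector [0, 1]],
     vector [vector [0, 1], vector [1, 0]],
     vector [vector [0, - \<i>], vector [\<i>, 0]],
     vector [vector [1, 0], vector [0, - 1]]] ! \<alpha>"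

definition prob_vector4 :: "(nat \<Rightarrow> real) \<Rightarrow> bool" where
  "prob_vector4 p \<longleftrightarrow> (\<forall>\<alpha><4. 0 \<le> p \<alpha>) \<and> (\<Sum>\<alpha><4. p \<alpha>) = 1"

definition pauli_channel :: "(nat \<Rightarrow> real) \<Rightarrow> complex^2^2 \<Rightarrow> complex^2^2" where
  "pauli_channel p \<rho> = (\<Sum>\<alpha><4. p \<alpha> *\<^sub>R (pauli \<alpha> ** \<rho> ** pauli \<alpha>))"

definition distortion_matrix :: "(nat \<Rightarrow> real) \<Rightarrow> real^3^3" where
  "distortion_matrix p = diag_matrix (vector
     [p 0 + p 1 - p 2 - p 3,
      p 0 - p 1 + p 2 - p 3,
      p 0 - p 1 - p 2 + p 3])"


section \<open>Binary entropy\<close>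

text \<open>Since \<open>log 2 0\<close> is multiplied by \<open>0\<close>, \<open>H2 0 = H2 1 = 0\<close>.\<close>

definition H2 :: "real \<Rightarrow> real" where
  "H2 x = - x * log 2 x - (1 - x) * log 2 (1 - x)"

definition f_ent :: "real \<Rightarrow> real" where
  "f_ent x = H2 ((1 - sqrt x) / 2)"


section \<open>Consistency of the definitions\<close>

lemma diag_matrix_mult_left: "(diag_matrix d ** A) $ i $ j = d $ i * (A $ i $ j)"
  for A :: "'a::semiring_1^'m^'n"
  by (simp add: diag_matrix_def matrix_matrix_mult_def if_distrib[of "\<lambda>x. x * _"] cong: if_cong)

lemma diag_matrix_mult_right: "(A ** diag_matrix d) $ i $ j = A $ i $ j * d $ j"
  for A :: "'a::semiring_1^'n^'m"
  by (simp add: diag_matrix_def matrix_matrix_mult_def if_distrib[of "\<lambda>x. _ * x"] cong: if_cong)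

lemma spectral_apply_unique:
  fixes A B C :: "complex^'n^'n"
  assumes "spectral_apply g A B" and "spectral_apply g A C"
  shows "B = C"
proof -
  obtain U and d :: "real^'n" where U: "unitary_matrix U"
    and AU: "A = U ** diag_matrix (\<chi> i. of_real (d $ i)) ** cadjoint U"
    and B: "B = U ** diag_matrix (\<chi> i. of_real (g (d $ i))) ** cadjoint U"
    using assms(1) unfolding spectral_apply_def by blast
  obtain V and e :: "real^'n" where V: "unitary_matrix V"
    and AV: "A = V ** diag_matrix (\<chi> i. of_real (e $ i)) ** cadjoint V"
    and C: "C = V ** diag_matrix (\<chi> i. of_real (g (e $ i))) ** cadjoint V"
    using assms(2) unfolding spectral_apply_def by blast
  define W where "W = cadjoint V ** U"
  have UU: "cadjoint U ** U = mat 1" "U ** cadjoint U = mat 1"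
    and VV: "cadjoint V ** V = mat 1" "V ** cadjoint V = mat 1"
    using U V by (auto simp: unitary_matrix_def)
  have L: "cadjoint V ** (U ** D ** cadjoint U) ** U = W ** D" for D
    by (metis W_def UU(1) matrix_mul_assoc matrix_mul_rid)
  have R: "cadjoint V ** (V ** D ** cadjoint V) ** U = D ** W" for D
    by (metis W_def VV(1) matrix_mul_assoc matrix_mul_lid)
  have comm: "W ** diag_matrix (\<chi> i. of_real (d $ i)) = diag_matrix (\<chi> i. of_real (e $ i)) ** W"
    using AU AV L R by metis
  have eq: "W $ i $ j * of_real (d $ j) = of_real (e $ i) * (W $ i $ j)" for i j
    using arg_cong[OF comm, of "\<lambda>M. M $ i $ j"]
    by (simp add: diag_matrix_mult_left diag_matrix_mult_right)
  have "W $ i $ j * of_real (g (d $ j)) = of_real (g (e $ i)) * (W $ i $ j)" for i j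
    using eq[of i j] by (cases "W $ i $ j = 0") auto
  then have "W ** diag_matrix (\<chi> i. of_real (g (d $ i)))
      = diag_matrix (\<chi> i. of_real (g (e $ i))) ** W"
    by (simp add: vec_eq_iff diag_matrix_mult_left diag_matrix_mult_right)
  then have "cadjoint V ** B ** U = cadjoint V ** C ** U"
    unfolding B C L R .
  then have "V ** (cadjoint V ** B ** U) ** cadjoint U = V ** (cadjoint V ** C ** U) ** cadjoint U"
    by simp
  then show ?thesis
    by (metis UU(2) VV(2) matrix_mul_assoc matrix_mul_lid matrix_mul_rid)
qed

lemma herm_fun_eq:
  fixes d :: "real^'n" and A :: "complex^'n^'n"
  assumes "unitary_matrix U" and "A = U ** diag_matrix (\<chi> i. of_real (d $ i)) ** cadjoint U"
  shows "herm_fun g A = U ** diag_matrix (\<chi> i. of_real (g (d $ i))) ** cadjoint U"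
proof -
  have "spectral_apply g A (U ** diag_matrix (\<chi> i. of_real (g (d $ i))) ** cadjoint U)"
    using assms unfolding spectral_apply_def by blast
  then show ?thesis
    unfolding herm_fun_def using spectral_apply_unique by blast
qed

definition bloch_state :: "real^3 \<Rightarrow> complex^2^2" where
  "bloch_state r = (1/2) *\<^sub>R (pauli 0 + r $ 1 *\<^sub>R pauli 1 + r $ 2 *\<^sub>R pauli 2 + r $ 3 *\<^sub>R pauli 3)"

lemma pauli_channel_bloch_state:
  assumes "prob_vector4 p"
  shows "pauli_channel p (bloch_state r) = bloch_state (distortion_matrix p *v r)"
proof -
  have s: "{..<4::nat} = {0, 1, 2, 3}" by auto
  have p0: "p 0 = 1 - p 1 - p 2 - p 3"
    using assms by (simp add: prob_vector4_def s)
  show ?thesis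
    by (simp add: p0 pauli_channel_def s bloch_state_def distortion_matrix_def diag_matrix_def
        pauli_def vec_eq_iff forall_2 matrix_matrix_mult_def matrix_vector_mult_def
        sum_2 sum_3 complex_eq_iff) (simp add: algebra_simps)
qed

end

theory Submission
  imports Defs
begin

text \<open>On Bloch vectors, \<open>QJSD\<close> of the two outputs for the input \<open>r\<close> equals
  \<open>G(u, v, w) = f(w) - (f(u) + f(v)) / 2\<close>, where \<open>(u, v, w)\<close> is linear in \<open>x = (r\<^sub>1\<^sup>2, r\<^sub>2\<^sup>2, r\<^sub>3\<^sup>2)\<close>
  and \<open>x\<close> ranges over the simplex \<open>x \<ge> 0\<close>, \<open>x\<^sub>1 + x\<^sub>2 + x\<^sub>3 \<le> 1\<close>. The vertices of the simplex give the
  right-hand side of the theorem and the value 0 at the origin, so it suffices that \<open>G\<close> is quasiconvex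
  on the region \<open>w \<le> (u + v) / 2\<close>; it is not convex there.

  Along a line, the second derivative of \<open>G\<close> is positive at every critical point: with \<open>h = - f\<close> and
  \<open>\<phi> = h'\<^sup>2 / h''\<close>, the Cauchy-Schwarz inequality reduces this to
  \<open>(\<phi>(u) + \<phi>(v)) / 2 < \<phi>(w)\<close>, which holds for \<open>w < (u + v) / 2\<close> if \<open>\<phi>\<close> is decreasing and
  concave; the boundary case is a limit. Substituting
  \<open>x = tanh\<^sup>2 (b / 2)\<close> turns both properties into the positivity of polynomials in
  \<open>b\<close>, \<open>sinh b\<close>, \<open>cosh b\<close>; the one for concavity has a power series with nonnegative coefficients.\<close>

section \<open>Inequalities for hyperbolic functions\<close>

lemma exp_times_power_sums:
  fixes b k :: real
  shows "(\<lambda>n. (\<Prod>i<j. real n - real i) * k ^ (n - j) / fact n * b ^ n) sums (b ^ j * exp (k * b))"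
proof (induction j)
  case 0
  show ?case
    using exp_converges[of "k * b"] by (simp add: power_mult_distrib field_simps)
next
  case (Suc j)
  define a where "a j n = (\<Prod>i<j. real n - real i) * k ^ (n - j) / fact n * b ^ n" for j n
  \<comment> \<open>The falling factorial vanishes for \<open>n < j\<close>, so the truncated
    exponent \<open>n - j\<close> does no harm there. Multiplication by \<open>b\<close> shifts the
    index by one: the factor for \<open>i = 0\<close> cancels against the factor
    \<open>n + 1\<close> of the factorial.\<close>
  have a0: "a (Suc j) 0 = 0"
    by (simp add: a_def lessThan_Suc_eq_insert_0)
  have cancel: "c * P * K / (c * F) * (b * B) = b * (P * K / F * B)" if "c \<noteq> 0" for c P K F B :: real
    using that by simp
  have shift: "real (Suc n) - real (Suc i) = real n - real i" for n i
    by simp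
  have "a (Suc j) (Suc n) = b * a j n" for n
    unfolding a_def using cancel[of "real (Suc n)"]
    by (subst prod.lessThan_Suc_shift) (simp del: prod.lessThan_Suc of_nat_Suc add: fact_Suc shift)
  then have "(\<lambda>n. a (Suc j) (Suc n)) sums (b * (b ^ j * exp (k * b)))"
    using sums_mult[OF Suc, of b] by (simp add: a_def)
  then show ?case
    unfolding sums_Suc_iff a0 by (simp only: a_def[abs_def] power_Suc diff_zero mult.assoc add_0_right)
qed

text \<open>This is the even part of \<open>b ^ j * exp (k * b)\<close> as a function of
  \<open>b\<close>. Averaging with the series for \<open>- k\<close>, weighted by
  \<open>(-1) ^ j\<close>, cancels all odd terms.\<close>

lemma hyperbolic_times_power_sums:
  fixes b k :: real
  shows "(\<lambda>n. (if even n then (\<Prod>i<j. real n - real i) * k ^ (n - j) / fact n else 0) * b ^ n)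
    sums (b ^ j * (if even j then cosh (k * b) else sinh (k * b)))"
proof -
  define P where "P n = (\<Prod>i<j. real n - real i)" for n
  have P: "P n = 0" if "n < j" for n
    using that by (auto simp: P_def)
  have "(\<lambda>n. 1/2 * (P n * k ^ (n - j) / fact n * b ^ n + (-1) ^ j * (P n * (- k) ^ (n - j) / fact n * b ^ n)))
    sums (1/2 * (b ^ j * exp (k * b) + (-1) ^ j * (b ^ j * exp (- k * b))))"
    unfolding P_def by (intro sums_mult sums_add exp_times_power_sums)
  moreover have "1/2 * (P n * k ^ (n - j) / fact n * b ^ n + (-1) ^ j * (P n * (- k) ^ (n - j) / fact n * b ^ n))
      = (if even n then P n * k ^ (n - j) / fact n else 0) * b ^ n" for n
  proof (cases "n < j")
    case True
    then show ?thesis by (simp add: P)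
  next
    case False
    then have "(-1) ^ j * (- k) ^ (n - j) = (-1) ^ n * k ^ (n - j)"
      by (metis (no_types, lifting) add_diff_inverse_nat mult.assoc power_add power_minus)
    then have "(-1) ^ j * (P n * (- k) ^ (n - j) / fact n * b ^ n) = (-1) ^ n * (P n * k ^ (n - j) / fact n * b ^ n)"
      by (metis (no_types, lifting) mult.assoc mult.left_commute times_divide_eq_right)
    moreover have "1/2 * (P n * k ^ (n - j) / fact n * b ^ n + (-1) ^ n * (P n * k ^ (n - j) / fact n * b ^ n))
        = (if even n then P n * k ^ (n - j) / fact n else 0) * b ^ n"
      by simp
    ultimately show ?thesis
      by (simp only:)
  qed
  moreover have "1/2 * (b ^ j * exp (k * b) + (-1) ^ j * (b ^ j * exp (- k * b)))
      = b ^ j * (if even j then cosh (k * b) else sinh (k * b))"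
    by (simp add: cosh_def sinh_def field_simps)
  ultimately show ?thesis
    by (simp only: P_def)
qed

text \<open>\<open>n!\<close> times the \<open>n\<close>-th Taylor coefficient (for even \<open>n\<close>) of the numerator of the derivative of
  \<open>hyp_slope\<close> below. It vanishes for \<open>n < 12\<close>.\<close>

definition hyp_slope_coeff :: "nat \<Rightarrow> real" where
  "hyp_slope_coeff n = - (4 ^ n / 4) + 2 ^ n + n * 4 ^ (n - 1) / 4 - n * 2 ^ (n - 1) / 2
     + 3/4 * (n * (real n - 1) * (3 ^ (n - 2) - 1))
     - n * (real n - 1) * (real n - 2) / 2 * (3 ^ (n - 3) + 2 ^ (n - 3) + 3)
     + (if n = 4 then 24 else 0) - (if n = 0 then 3/4 else 0)"

section \<open>Nonnegativity of the Taylor coefficients\<close>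

lemma powers_2_3_4_bounds:
  fixes n :: nat
  assumes "30 \<le> n"
  shows "2 * (real n)\<^sup>2 * 3 ^ n \<le> 4 ^ n" "1000 * 2 ^ n \<le> (3 ^ n :: real)"
proof -
  show "2 * (real n)\<^sup>2 * 3 ^ n \<le> 4 ^ n"
    using assms
  proof (induction n rule: nat_induct_at_least)
    case (Suc n)
    have "30 * real n \<le> real n * real n"
      using Suc by (intro mult_right_mono) auto
    then have "3 + real n * 6 \<le> real n * real n"
      using Suc.hyps by linarith
    then have "3 * (real (Suc n))\<^sup>2 \<le> 4 * (real n)\<^sup>2"
      using Suc.hyps unfolding power2_eq_square by (simp add: algebra_simps del: mult_le_cancel_right)
    then have "2 * 3 ^ n * (3 * (real (Suc n))\<^sup>2) \<le> 2 * 3 ^ n * (4 * (real n)\<^sup>2)"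
      by (intro mult_left_mono) auto
    also have "\<dots> = 4 * (2 * (real n)\<^sup>2 * 3 ^ n)"
      by (simp only: mult_ac)
    also have "\<dots> \<le> 4 * 4 ^ n"
      using Suc.IH by (intro mult_left_mono) auto
    finally show ?case
      by (simp only: power_Suc mult_ac)
  qed simp
  show "1000 * 2 ^ n \<le> (3 ^ n :: real)"
    using assms
  proof (induction n rule: nat_induct_at_least)
    case (Suc n)
    have "1000 * (2::real) ^ Suc n \<le> 2 * 3 ^ n"
      using Suc.IH by simp
    also have "\<dots> \<le> 3 ^ Suc n"
      by simp
    finally show ?case .
  qed simp
qed

text \<open>The terms with \<open>4 ^ n\<close> combine to \<open>4 ^ n * (n - 4) / 16\<close>. From
  30 on, this dominates the cubic multiple of \<open>3 ^ n\<close> and all other negative terms,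
  each of which is bounded by a small multiple of \<open>n * 4 ^ n\<close>.\<close>

lemma hyp_slope_coeff_nonneg_large:
  assumes "30 \<le> n"
  shows "hyp_slope_coeff n \<ge> 0"
proof -
  \<comment> \<open>With \<open>n = m + 3\<close> the truncated exponents \<open>n - 1\<close>,
    \<open>n - 2\<close> and \<open>n - 3\<close> become genuine ones.\<close>
  define m where "m = n - 3"
  have n: "n = m + 3" using assms by (simp add: m_def)
  define X Y Z :: real where "X = 4 ^ n" and "Y = 3 ^ n" and "Z = 2 ^ n"
  define r where "r = real n"
  have r: "r \<ge> 30" using assms by (simp add: r_def)
  have XY: "2 * r\<^sup>2 * Y \<le> X" and ZY: "1000 * Z \<le> Y"
    using powers_2_3_4_bounds[OF assms] by (auto simp: X_def Y_def Z_def r_def)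
  have Z: "Z \<ge> 1000"
  proof -
    have "(2::real) ^ 10 \<le> 2 ^ n" using assms by (intro power_increasing) auto
    then show ?thesis by (simp add: Z_def)
  qed
  have eq: "hyp_slope_coeff n = X * (r - 4) / 16 + Z - r * Z / 4 + 3/4 * (r * (r - 1) * (Y / 9 - 1))
     - r * (r - 1) * (r - 2) / 2 * (Y / 27 + Z / 8 + 3)"
  proof -
    have ne: "n \<noteq> 4" "n \<noteq> 0" using assms by auto
    have pw: "4 ^ (n - 1) = X / 4" "2 ^ (n - 1) = Z / 2" "3 ^ (n - 2) = Y / 9"
      "3 ^ (n - 3) = Y / 27" "2 ^ (n - 3) = Z / 8"
      by (simp_all add: X_def Y_def Z_def n power_add)
    show ?thesis
      unfolding hyp_slope_coeff_def pw using ne by (simp add: X_def Y_def Z_def r_def field_simps)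
  qed
  have t1: "3/4 * (r * (r - 1) * (Y / 9 - 1)) \<ge> 0"
    using r Z ZY by (intro mult_nonneg_nonneg) auto
  have "r * (r - 1) * (r - 2) \<le> r * r * r"
    using r by (intro mult_mono) auto
  then have "r * (r - 1) * (r - 2) / 2 * (Y / 27 + Z / 8 + 3) \<le> r * r * r / 2 * (Y / 25)"
    using r Z ZY by (intro mult_mono) auto
  also have "\<dots> = r / 100 * (2 * r\<^sup>2 * Y)"
    by (simp add: power2_eq_square)
  also have "\<dots> \<le> r / 100 * X"
    using XY r by (intro mult_left_mono) auto
  finally have t2: "r * (r - 1) * (r - 2) / 2 * (Y / 27 + Z / 8 + 3) \<le> r / 100 * X" .
  have "1 * 1 \<le> r * r" using r by (intro mult_mono) auto
  then have "1 \<le> 2 * r\<^sup>2" by (simp add: power2_eq_square)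
  then have "Y * 1 \<le> Y * (2 * r\<^sup>2)"
    using Z ZY by (intro mult_left_mono) auto
  then have "1000 * Z \<le> Y * (2 * r\<^sup>2)"
    using ZY by linarith
  then have "1000 * Z \<le> X" using XY by (simp add: mult_ac)
  then have t3: "r * Z / 4 \<le> r * X / 4000"
    using r by (simp add: mult_left_mono)
  have t4: "30 * X \<le> r * X" using r by (intro mult_right_mono) (auto simp: X_def)
  have "0 < X" by (simp add: X_def)
  have "X * (r - 4) = r * X - 4 * X" by (simp add: algebra_simps)
  then have "0 \<le> X * (r - 4) / 16 + Z - r * Z / 4 + t - q" if "0 \<le> t" "q \<le> r / 100 * X" for t q
    using that t3 t4 \<open>0 < X\<close> Z by linarith
  from this[OF t1 t2] show ?thesis
    unfolding eq .
qed

lemma hyp_slope_coeff_nonneg: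
  assumes "even n"
  shows "hyp_slope_coeff n \<ge> 0"
proof (cases "n < 30")
  case True
  have "\<forall>n\<in>{0,2,4,6,8,10,12,14,16,18,20,22,24,26,28}. hyp_slope_coeff n \<ge> 0"
    by (simp add: hyp_slope_coeff_def)
  moreover have "n \<in> {0,2,4,6,8,10,12,14,16,18,20,22,24,26,28}"
    unfolding insert_iff empty_iff using assms True by presburger
  ultimately show ?thesis by blast
qed (simp add: hyp_slope_coeff_nonneg_large)

lemma hyp_slope_numerator_expanded_pos:
  fixes b :: real
  assumes "0 < b"
  shows "0 < - cosh (4 * b) / 4 + cosh (2 * b) + b * sinh (4 * b) / 4 - b * sinh (2 * b) / 2
    + 3/4 * (b\<^sup>2 * (cosh (3 * b) - cosh b)) - b ^ 3 / 2 * (sinh (3 * b) + sinh (2 * b) + 3 * sinh b)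
    + b ^ 4 - 3/4" (is "0 < ?E")
proof -
  define T where "T j k n = (if even n then (\<Prod>i<j. real n - real i) * k ^ (n - j) / fact n else 0) * b ^ n" for j n and k :: real
  have T: "T j k sums (b ^ j * (if even j then cosh (k * b) else sinh (k * b)))" for j k
    unfolding T_def by (rule hyperbolic_times_power_sums)
  have T0: "T 0 k sums cosh (k * b)" and T1: "T 1 k sums (b * sinh (k * b))"
    and T2: "T 2 k sums (b\<^sup>2 * cosh (k * b))" and T3: "T 3 k sums (b ^ 3 * sinh (k * b))" for k
    using T[of 0 k] T[of 1 k] T[of 2 k] T[of 3 k] by auto
  have s: "(\<lambda>n. - 1/4 * T 0 4 n + T 0 2 n + 1/4 * T 1 4 n - 1/2 * T 1 2 n
      + 3/4 * (T 2 3 n - T 2 1 n) - 1/2 * (T 3 3 n + T 3 2 n + 3 * T 3 1 n)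
      + (if n = 4 then b ^ 4 else 0) - (if n = 0 then 3/4 else 0))
    sums (- 1/4 * cosh (4 * b) + cosh (2 * b) + 1/4 * (b * sinh (4 * b)) - 1/2 * (b * sinh (2 * b))
      + 3/4 * (b\<^sup>2 * cosh (3 * b) - b\<^sup>2 * cosh (1 * b))
      - 1/2 * (b ^ 3 * sinh (3 * b) + b ^ 3 * sinh (2 * b) + 3 * (b ^ 3 * sinh (1 * b))) + b ^ 4 - 3/4)"
    by (intro sums_add sums_diff sums_mult T0 T1 T2 T3 sums_single)
  have "(\<lambda>n. (if even n then hyp_slope_coeff n / fact n else 0) * b ^ n) sums ?E"
  proof (rule sums_cong[THEN iffD1, OF _ s[THEN back_subst[of "(sums) _"]]])
    fix n
    show "- 1/4 * T 0 4 n + T 0 2 n + 1/4 * T 1 4 n - 1/2 * T 1 2 n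
      + 3/4 * (T 2 3 n - T 2 1 n) - 1/2 * (T 3 3 n + T 3 2 n + 3 * T 3 1 n)
      + (if n = 4 then b ^ 4 else 0) - (if n = 0 then 3/4 else 0)
      = (if even n then hyp_slope_coeff n / fact n else 0) * b ^ n"
    proof (cases "even n")
      case True
      \<comment> \<open>All terms share the factor \<open>b ^ n / n!\<close>. The isolated
        \<open>b ^ 4\<close> has coefficient 4! = 24 with respect to it.\<close>
      define w where "w = b ^ n / fact n"
      define e4 e0 :: real where "e4 = (if n = 4 then 24 else 0)" and "e0 = (if n = 0 then 3/4 else 0)"
      have e: "(if n = 4 then b ^ 4 else 0) = e4 * w" "(if n = 0 then 3/4 else 0) = e0 * w"
        by (auto simp: e4_def e0_def w_def fact_numeral)
      have T': "T 0 k n = k ^ n * w" "T 1 k n = n * k ^ (n - 1) * w"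
        "T 2 k n = n * (real n - 1) * k ^ (n - 2) * w"
        "T 3 k n = n * (real n - 1) * (real n - 2) * k ^ (n - 3) * w" for k :: real
        using True by (auto simp: T_def w_def numeral_2_eq_2 numeral_3_eq_3)
      have c: "(if even n then hyp_slope_coeff n / fact n else 0) * b ^ n = hyp_slope_coeff n * w"
        using True by (simp add: w_def)
      show ?thesis
        unfolding c unfolding T' e unfolding hyp_slope_coeff_def
        unfolding e4_def[symmetric] e0_def[symmetric]
        by (simp add: field_simps)
    qed (auto simp: T_def dest: odd_pos)
  qed (simp add: algebra_simps)
  then have "?E = suminf (\<lambda>n. (if even n then hyp_slope_coeff n / fact n else 0) * b ^ n)"
    and "summable (\<lambda>n. (if even n then hyp_slope_coeff n / fact n else 0) * b ^ n)"
    by (auto simp: sums_iff)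
  \<comment> \<open>One positive coefficient turns nonnegativity of the sum into strict
    positivity.\<close>
  moreover have "hyp_slope_coeff 12 > 0"
    by (simp add: hyp_slope_coeff_def)
  then have "(if even (12::nat) then hyp_slope_coeff 12 / fact 12 else 0) * b ^ 12 > 0"
    using assms by simp
  ultimately show ?thesis
    using assms hyp_slope_coeff_nonneg by (auto intro!: suminf_pos2[where i = 12])
qed

text \<open>The multiple-angle formulas turn this polynomial in \<open>b\<close>, \<open>S\<close>,
  \<open>C\<close> into a linear combination of powers of \<open>b\<close> times hyperbolic
  functions of multiples of \<open>b\<close>, whose Taylor coefficients are explicit. The factor
  multiplying \<open>b * S * (S - b)\<close> is the derivative of \<open>N\<close>.\<close>

lemma hyp_slope_numerator_pos:
  fixes b :: real
  assumes "0 < b"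
  defines "S \<equiv> sinh b" and "C \<equiv> cosh b"
  defines "N \<equiv> b * S * C + b\<^sup>2 - 2 * S\<^sup>2"
  shows "0 < N * (S - b)\<^sup>2 + (b * (2 * C\<^sup>2 + 1) - 3 * S * C) * b * S * (S - b) - 2 * (C - 1) * b * S * N"
proof -
  have C2: "C\<^sup>2 = 1 + S\<^sup>2" by (simp add: S_def C_def cosh_square_eq)
  then have CC1: "C * C = 1 + S * S"
    by (simp add: power2_eq_square)
  \<comment> \<open>Together with \<open>CC1\<close> this removes squares of \<open>C\<close> inside
    longer products as well, so that simplification reaches a normal form at most linear in
    \<open>C\<close>.\<close>
  have CC2: "C * (C * x) = x + S * (S * x)" for x
    by (metis CC1 mult.assoc distrib_right mult_1)
  note CC = CC1 CC2
  note power_eqs = power2_eq_square power3_eq_cube power4_eq_xxxx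
  have c2: "cosh (2 * b) = 1 + 2 * S\<^sup>2" "sinh (2 * b) = 2 * S * C"
    using C2 by (simp_all add: S_def C_def cosh_double sinh_double)
  have "cosh (2 * b + b) = C * (1 + 4 * S\<^sup>2)" "sinh (2 * b + b) = S * (3 + 4 * S\<^sup>2)"
    unfolding cosh_add sinh_add c2
    by (auto simp: power_eqs CC algebra_simps simp flip: S_def C_def)
  then have c3: "cosh (3 * b) = C * (1 + 4 * S\<^sup>2)" "sinh (3 * b) = S * (3 + 4 * S\<^sup>2)"
    by (simp_all add: algebra_simps)
  have "cosh (2 * b + 2 * b) = 1 + 8 * S\<^sup>2 + 8 * S ^ 4" "sinh (2 * b + 2 * b) = 4 * S * C * (1 + 2 * S\<^sup>2)"
    unfolding cosh_add sinh_add c2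
    by (auto simp: power_eqs CC algebra_simps)
  then have c4: "cosh (4 * b) = 1 + 8 * S\<^sup>2 + 8 * S ^ 4" "sinh (4 * b) = 4 * S * C * (1 + 2 * S\<^sup>2)"
    by (simp_all add: algebra_simps)
  have "N * (S - b)\<^sup>2 + (b * (2 * C\<^sup>2 + 1) - 3 * S * C) * b * S * (S - b) - 2 * (C - 1) * b * S * N
    = - cosh (4 * b) / 4 + cosh (2 * b) + b * sinh (4 * b) / 4 - b * sinh (2 * b) / 2
    + 3/4 * (b\<^sup>2 * (cosh (3 * b) - C)) - b ^ 3 / 2 * (sinh (3 * b) + sinh (2 * b) + 3 * S)
    + b ^ 4 - 3/4"
    unfolding c2 c3 c4 N_def by (simp add: power_eqs CC field_simps)
  then show ?thesis
    using hyp_slope_numerator_expanded_pos[OF assms(1)] by (simp add: S_def C_def)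
qed

section \<open>Elementary hyperbolic inequalities by repeated differentiation\<close>

lemma pos_of_deriv_pos:
  fixes f f' :: "real \<Rightarrow> real"
  assumes "\<And>x. (f has_real_derivative f' x) (at x)" and "\<And>x. 0 < x \<Longrightarrow> 0 < f' x"
    and "f 0 = 0" and "0 < x"
  shows "0 < f x"
proof -
  have "continuous_on {0..x} f"
    using assms(1) by (meson DERIV_isCont continuous_at_imp_continuous_on)
  then have "f 0 < f x"
    using assms(1,2,4) by (intro DERIV_pos_imp_increasing_open[of 0 x f]) blast+
  then show ?thesis
    using assms(3) by simp
qed

lemma sinh_gt_self:
  fixes b :: real
  assumes "0 < b"
  shows "b < sinh b"
proof -
  have "((\<lambda>b. sinh b - b) has_real_derivative cosh x - 1) (at x)" for x :: real
    by (auto intro!: derivative_eq_intros)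
  moreover have "0 < cosh x - 1" if "0 < x" for x :: real
    using cosh_real_strict_mono[of 0 x] that by simp
  ultimately show ?thesis
    using pos_of_deriv_pos[of "\<lambda>b. sinh b - b" "\<lambda>x. cosh x - 1"] assms by simp
qed

lemma hyperbolic_numerator_pos:
  fixes b :: real
  assumes "0 < b"
  shows "0 < b * sinh b * cosh b + b\<^sup>2 - 2 * (sinh b)\<^sup>2"
proof -
  \<comment> \<open>Each function vanishes at 0 and is the derivative of the next one, so positivity
    propagates upwards from \<open>x * sinh x\<close>. The last function at \<open>2 * b\<close> is
    four times the claimed expression.\<close>
  have d1: "((\<lambda>x. x * cosh x - sinh x) has_real_derivative x * sinh x) (at x)"
    and d2: "((\<lambda>x. x * sinh x - 2 * cosh x + 2) has_real_derivative x * cosh x - sinh x) (at x)"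
    and d3: "((\<lambda>x. x * (cosh x + 2) - 3 * sinh x) has_real_derivative x * sinh x - 2 * cosh x + 2) (at x)"
    and d4: "((\<lambda>x. x * sinh x + x\<^sup>2 - 4 * (cosh x - 1)) has_real_derivative x * (cosh x + 2) - 3 * sinh x) (at x)"
    for x :: real
    by (auto intro!: derivative_eq_intros simp: algebra_simps)
  have p1: "0 < x * cosh x - sinh x" if "0 < x" for x :: real
    using pos_of_deriv_pos[OF d1 _ _ that] by simp
  have p2: "0 < x * sinh x - 2 * cosh x + 2" if "0 < x" for x :: real
    using pos_of_deriv_pos[OF d2 p1 _ that] by simp
  have p3: "0 < x * (cosh x + 2) - 3 * sinh x" if "0 < x" for x :: real
    using pos_of_deriv_pos[OF d3 p2 _ that] by simp
  have "0 < x * sinh x + x\<^sup>2 - 4 * (cosh x - 1)" if "0 < x" for x :: real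
    using pos_of_deriv_pos[OF d4 p3 _ that] by simp
  from this[of "2 * b"] show ?thesis
    using assms unfolding sinh_double cosh_double cosh_square_eq by (simp add: algebra_simps power2_eq_square)
qed

section \<open>Lines through the Jensen gap\<close>

lemma segment_in_unit_interval:
  fixes a b t :: real
  assumes "0 < a" "a < 1" "0 < b" "b < 1" "0 \<le> t" "t \<le> 1"
  shows "0 < a + t * (b - a)" "a + t * (b - a) < 1"
proof -
  have "a + t * (b - a) = (1 - t) * a + t * b" by (simp add: algebra_simps)
  moreover have "0 < (1 - t) * a + t * b"
    using assms by (cases "t = 0") (auto intro!: add_nonneg_pos mult_nonneg_nonneg)
  moreover have "(1 - t) * a + t * b < 1"
    using assms by (intro convex_bound_lt) auto
  ultimately show "0 < a + t * (b - a)" "a + t * (b - a) < 1" by auto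
qed

text \<open>Cauchy-Schwarz with weights \<open>p\<close> and \<open>q\<close>; the difference of the
  two sides is an explicit square over \<open>4 * p * q\<close>.\<close>

lemma weighted_cauchy_schwarz:
  fixes a b p q U V :: real
  assumes "0 < p" "0 < q"
  shows "((a * U + b * V) / 2)\<^sup>2 \<le> ((p * U\<^sup>2 + q * V\<^sup>2) / 2) * ((a\<^sup>2 / p + b\<^sup>2 / q) / 2)"
proof -
  have "((p * U\<^sup>2 + q * V\<^sup>2) / 2) * ((a\<^sup>2 / p + b\<^sup>2 / q) / 2) - ((a * U + b * V) / 2)\<^sup>2
    = (p * b * U - q * a * V)\<^sup>2 / (4 * p * q)"
    using assms by (simp add: field_simps power2_eq_square)
  also have "\<dots> \<ge> 0" using assms by simp
  finally show ?thesis by simp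
qed

text \<open>With \<open>\<phi> = g'\<^sup>2 / g''\<close> decreasing and midpoint concave, \<open>G'' > 0\<close> at every critical point
  of \<open>G\<close>, so \<open>G\<close> has no interior maximum.\<close>

lemma jensen_gap_le_max_endpoints:
  fixes g g' g'' :: "real \<Rightarrow> real" and u0 u1 v0 v1 w0 w1 :: real
  assumes d1: "\<And>x. 0 < x \<Longrightarrow> x < 1 \<Longrightarrow> (g has_real_derivative g' x) (at x)"
    and d2: "\<And>x. 0 < x \<Longrightarrow> x < 1 \<Longrightarrow> (g' has_real_derivative g'' x) (at x)"
    and p1: "\<And>x. 0 < x \<Longrightarrow> x < 1 \<Longrightarrow> 0 < g' x"
    and p2: "\<And>x. 0 < x \<Longrightarrow> x < 1 \<Longrightarrow> 0 < g'' x"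
    and anti: "\<And>x y. 0 < x \<Longrightarrow> x < y \<Longrightarrow> y < 1 \<Longrightarrow> (g' y)\<^sup>2 / g'' y < (g' x)\<^sup>2 / g'' x"
    and conc: "\<And>x y. 0 < x \<Longrightarrow> x < 1 \<Longrightarrow> 0 < y \<Longrightarrow> y < 1 \<Longrightarrow>
      ((g' x)\<^sup>2 / g'' x + (g' y)\<^sup>2 / g'' y) / 2 \<le> (g' ((x + y) / 2))\<^sup>2 / g'' ((x + y) / 2)"
    and u: "0 < u0" "u0 < 1" "0 < u1" "u1 < 1" and v: "0 < v0" "v0 < 1" "0 < v1" "v1 < 1"
    and w: "0 < w0" "w0 < (u0 + v0) / 2" "0 < w1" "w1 < (u1 + v1) / 2"
    and t: "0 \<le> t" "t \<le> 1"
  defines "G \<equiv> \<lambda>t. (g (u0 + t * (u1 - u0)) + g (v0 + t * (v1 - v0))) / 2 - g (w0 + t * (w1 - w0))"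
  shows "G t \<le> max (G 0) (G 1)"
proof -
  define U V W where "U = u1 - u0" and "V = v1 - v0" and "W = w1 - w0"
  define \<phi> where "\<phi> x = (g' x)\<^sup>2 / g'' x" for x
  define G' where "G' t = (g' (u0 + t * U) * U + g' (v0 + t * V) * V) / 2 - g' (w0 + t * W) * W" for t
  have w': "w0 < 1" "w1 < 1" using u v w by auto
  have in_unit: "0 < u0 + t * U" "u0 + t * U < 1" "0 < v0 + t * V" "v0 + t * V < 1"
    "0 < w0 + t * W" "w0 + t * W < 1" "w0 + t * W < ((u0 + t * U) + (v0 + t * V)) / 2"
    if "0 \<le> t" "t \<le> 1" for t
  proof -
    \<comment> \<open>The slack \<open>(u + v) / 2 - w\<close> is affine along the segment and lies
      strictly between 0 and 1 at both ends.\<close>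
    have "0 < ((u0 + v0) / 2 - w0) + t * (((u1 + v1) / 2 - w1) - ((u0 + v0) / 2 - w0))"
      using that u v w by (intro segment_in_unit_interval) (simp_all add: field_simps)
    then show "w0 + t * W < ((u0 + t * U) + (v0 + t * V)) / 2"
      by (simp add: U_def V_def W_def field_simps)
  qed (use segment_in_unit_interval that u v w w' in \<open>auto simp: U_def V_def W_def\<close>)
  have dG: "(G has_real_derivative G' t) (at t)" if t: "0 \<le> t" "t \<le> 1" for t
    unfolding G_def G'_def U_def[symmetric] V_def[symmetric] W_def[symmetric]
    using in_unit[OF t]
    by (auto intro!: derivative_eq_intros DERIV_chain2[OF d1])
  have dG': "(G' has_real_derivative (g'' (u0 + t * U) * U\<^sup>2 + g'' (v0 + t * V) * V\<^sup>2) / 2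
      - g'' (w0 + t * W) * W\<^sup>2) (at t)" if t: "0 \<le> t" "t \<le> 1" for t
    unfolding G'_def using in_unit[OF t]
    by (auto intro!: derivative_eq_intros DERIV_chain2[OF d2] simp: power2_eq_square)
  have cont: "continuous_on {0..1} G"
    using dG by (intro continuous_at_imp_continuous_on ballI) (auto intro: DERIV_isCont)
  obtain m where m: "0 \<le> m" "m \<le> 1" and max: "\<And>t. 0 \<le> t \<Longrightarrow> t \<le> 1 \<Longrightarrow> G t \<le> G m"
    using continuous_attains_sup[OF _ _ cont] by auto
  show ?thesis
  proof (cases "m = 0 \<or> m = 1")
    case True
    then show ?thesis using max[OF t] by auto
  next
    case False
    then have m01: "0 < m" "m < 1" using m by auto
    have "G' m = 0"
    proof (rule DERIV_local_max[OF dG[OF m]])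
      show "0 < min m (1 - m)" using m01 by simp
      show "\<forall>y. \<bar>m - y\<bar> < min m (1 - m) \<longrightarrow> G y \<le> G m"
        using max by (auto simp: abs_if split: if_splits)
    qed
    note I = in_unit[OF m]
    define a b c p q r where "a = g' (u0 + m * U)" and "b = g' (v0 + m * V)" and "c = g' (w0 + m * W)"
      and "p = g'' (u0 + m * U)" and "q = g'' (v0 + m * V)" and "r = g'' (w0 + m * W)"
    have pos: "0 < a" "0 < b" "0 < c" "0 < p" "0 < q" "0 < r"
      using p1 p2 I by (auto simp: a_def b_def c_def p_def q_def r_def)
    have crit: "c * W = (a * U + b * V) / 2"
      using \<open>G' m = 0\<close> by (simp add: G'_def a_def b_def c_def)
    show ?thesis
    proof (cases "U = 0 \<and> V = 0")
      case True
      \<comment> \<open>If \<open>u\<close> and \<open>v\<close> do not move, criticality stops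
        \<open>w\<close> too, and \<open>G\<close> is constant.\<close>
      then have "W = 0" using crit pos by simp
      then show ?thesis using True by (simp add: G_def U_def V_def W_def)
    next
      case False
      define Q where "Q = (p * U\<^sup>2 + q * V\<^sup>2) / 2"
      have Q: "Q > 0"
      proof -
        have "0 \<le> p * U\<^sup>2" "0 \<le> q * V\<^sup>2" "0 < p * U\<^sup>2 \<or> 0 < q * V\<^sup>2"
          using False pos by auto
        then show ?thesis by (auto simp: Q_def)
      qed
      \<comment> \<open>Concavity bounds the mean of \<phi> by its value at the midpoint of
        \<open>u\<close> and \<open>v\<close>; as \<open>w\<close> lies strictly below that
        midpoint, \<phi> is strictly larger at \<open>w\<close>.\<close>
      have "(a\<^sup>2 / p + b\<^sup>2 / q) / 2 \<le> \<phi> (((u0 + m * U) + (v0 + m * V)) / 2)"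
        using conc I by (simp add: \<phi>_def a_def b_def p_def q_def)
      also have "\<dots> < c\<^sup>2 / r"
        using anti[of "w0 + m * W"] I by (simp add: \<phi>_def c_def r_def)
      finally have less: "(a\<^sup>2 / p + b\<^sup>2 / q) / 2 < c\<^sup>2 / r" .
      have "(c * W)\<^sup>2 \<le> Q * ((a\<^sup>2 / p + b\<^sup>2 / q) / 2)"
        unfolding crit Q_def using pos by (intro weighted_cauchy_schwarz)
      also have "\<dots> < Q * (c\<^sup>2 / r)"
        using less Q by (rule mult_strict_left_mono)
      finally have "c\<^sup>2 * (r * W\<^sup>2) < c\<^sup>2 * Q"
        using pos by (simp add: field_simps power2_eq_square)
      \<comment> \<open>The right-hand side is the second derivative of \<open>G\<close> at
        \<open>m\<close>. Hence \<open>G'\<close> rises from its zero at \<open>m\<close>, and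
        \<open>G\<close> increases strictly just to the right of \<open>m\<close>, against
        maximality.\<close>
      then have "0 < Q - r * W\<^sup>2"
        using pos by simp
      then obtain d where d: "d > 0" "\<And>h. 0 < h \<Longrightarrow> h < d \<Longrightarrow> G' m < G' (m + h)"
        using DERIV_pos_inc_right[OF dG'[OF m]] by (auto simp: Q_def p_def q_def r_def)
      define h where "h = min (d / 2) (1 - m)"
      have h: "0 < h" "h < d" "m + h \<le> 1" using d m01 by (auto simp: h_def)
      have "G m < G (m + h)"
      proof (rule DERIV_pos_imp_increasing_open[where f = G])
        show "\<exists>y. DERIV G x :> y \<and> 0 < y" if "m < x" "x < m + h" for x
          using dG[of x] d(2)[of "x - m"] that h m \<open>G' m = 0\<close> by (intro exI[of _ "G' x"]) auto
        show "continuous_on {m..m + h} G"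
          using continuous_on_subset[OF cont] h m by auto
      qed (use h in auto)
      then show ?thesis
        using max[of "m + h"] h m by auto
    qed
  qed
qed

section \<open>The slope ratio of the binary entropy\<close>

text \<open>This is \<open>2 * artanh (sqrt x)\<close>, the inverse of
  \<open>x = tanh\<^sup>2 (b / 2)\<close>. It is also the logarithm of the quotient of the two
  eigenvalues of a qubit state with squared Bloch length \<open>x\<close>.\<close>

definition log_ratio :: "real \<Rightarrow> real" where
  "log_ratio x = ln ((1 + sqrt x) / (1 - sqrt x))"

lemma log_ratio_hyperbolic:
  assumes "0 < x" "x < 1"
  shows "0 < log_ratio x" "sinh (log_ratio x) = 2 * sqrt x / (1 - x)"
    "cosh (log_ratio x) = (1 + x) / (1 - x)"
proof -
  define s where "s = sqrt x"
  have s: "0 < s" "s < 1" and x: "x = s\<^sup>2" using assms by (auto simp: s_def)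
  have r: "1 < (1 + s) / (1 - s)" using s by simp
  then have r0: "0 < (1 + s) / (1 - s)" by linarith
  show "0 < log_ratio x" using r by (simp add: log_ratio_def s_def)
  have d: "1 - x = (1 - s) * (1 + s)" by (simp add: x power2_eq_square algebra_simps)
  have "sinh (log_ratio x) = ((1 + s) / (1 - s) - (1 - s) / (1 + s)) / 2"
    unfolding log_ratio_def s_def[symmetric] sinh_ln_real[OF r0] by simp
  also have "\<dots> = 2 * s / ((1 - s) * (1 + s))"
    using s by (simp add: divide_simps) (simp add: algebra_simps)
  finally show "sinh (log_ratio x) = 2 * sqrt x / (1 - x)"
    unfolding d by (simp add: s_def)
  have "cosh (log_ratio x) = ((1 + s) / (1 - s) + (1 - s) / (1 + s)) / 2"
    unfolding log_ratio_def s_def[symmetric] cosh_ln_real[OF r0] by simp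
  also have "\<dots> = (1 + s\<^sup>2) / ((1 - s) * (1 + s))"
    using s by (simp add: divide_simps) (simp add: power2_eq_square algebra_simps)
  finally show "cosh (log_ratio x) = (1 + x) / (1 - x)"
    unfolding d by (simp add: x)
qed

lemma log_ratio_deriv:
  assumes "0 < x" "x < 1"
  shows "(log_ratio has_real_derivative 1 / (sqrt x * (1 - x))) (at x)"
proof -
  define s where "s = sqrt x"
  have s: "0 < s" "s < 1" using assms by (auto simp: s_def)
  have "1 - s\<^sup>2 = (1 - s) * (1 + s)" by (simp add: power2_eq_square algebra_simps)
  moreover have "(((1 - s) - (1 + s) * (-1)) / ((1 - s) * (1 - s))) / ((1 + s) / (1 - s)) = 2 / ((1 - s) * (1 + s))"
    using s by (simp add: divide_simps)
  moreover have "((\<lambda>s. ln ((1 + s) / (1 - s))) has_real_derivative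
      (((1 - s) - (1 + s) * (-1)) / ((1 - s) * (1 - s))) / ((1 + s) / (1 - s))) (at s)"
    using s by (auto intro!: derivative_eq_intros simp: mult_ac)
  ultimately have "((\<lambda>s. ln ((1 + s) / (1 - s))) has_real_derivative 2 / (1 - s\<^sup>2)) (at (sqrt x))"
    by (simp add: s_def)
  then have "((\<lambda>x. ln ((1 + sqrt x) / (1 - sqrt x))) has_real_derivative
      2 / (1 - s\<^sup>2) * (inverse (sqrt x) / 2)) (at x)"
    by (rule DERIV_chain2[OF _ DERIV_real_sqrt]) (use assms in auto)
  moreover have "2 / (1 - s\<^sup>2) * (inverse (sqrt x) / 2) = 1 / (sqrt x * (1 - x))"
    using assms by (simp add: s_def field_simps)
  ultimately show ?thesis
    unfolding log_ratio_def[abs_def] by simp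
qed

lemma f_ent_deriv:
  assumes "0 < x" "x < 1"
  shows "((\<lambda>x. - 4 * ln 2 * f_ent x) has_real_derivative log_ratio x / sqrt x) (at x)"
proof -
  define s where "s = sqrt x"
  have s: "0 < s" "s < 1" using assms by (auto simp: s_def)
  \<comment> \<open>The factor \<open>- 4 * ln 2\<close> passes to natural logarithms, clears the
    constants of the chain rule and makes the derivative positive.\<close>
  define F where "F s = 4 * ((1 - s) / 2 * ln ((1 - s) / 2) + (1 + s) / 2 * ln ((1 + s) / 2))" for s :: real
  have F: "- 4 * ln 2 * f_ent x = F (sqrt x)" for x
  proof -
    have "1 - (1 - sqrt x) / 2 = (1 + sqrt x) / 2" by (simp add: field_simps)
    then show ?thesis
      by (simp add: f_ent_def H2_def F_def log_def field_simps)
  qed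
  have "(F has_real_derivative 2 * (ln ((1 + s) / 2) - ln ((1 - s) / 2))) (at s)"
  proof -
    have ent: "((\<lambda>y. y * ln y) has_real_derivative ln y + 1) (at y)" if "0 < y" for y :: real
      using that by (auto intro!: derivative_eq_intros)
    have "(F has_real_derivative 4 * ((ln ((1 - s) / 2) + 1) * (-1/2) + (ln ((1 + s) / 2) + 1) * (1/2))) (at s)"
      unfolding F_def[abs_def] using s
      by (intro DERIV_cmult DERIV_add DERIV_chain2[OF ent, of _ s])
        (auto intro!: derivative_eq_intros)
    then show ?thesis by (simp add: algebra_simps)
  qed
  then have "((\<lambda>x. F (sqrt x)) has_real_derivative
      2 * (ln ((1 + s) / 2) - ln ((1 - s) / 2)) * (inverse (sqrt x) / 2)) (at x)"
    unfolding s_def by (rule DERIV_chain2[OF _ DERIV_real_sqrt]) (use assms in auto)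
  moreover have "2 * (ln ((1 + s) / 2) - ln ((1 - s) / 2)) * (inverse (sqrt x) / 2) = log_ratio x / sqrt x"
    using s unfolding log_ratio_def s_def[symmetric] by (simp add: ln_div field_simps)
  ultimately show ?thesis
    unfolding F by simp
qed

text \<open>This is the second derivative of \<open>- 4 * ln 2 * f_ent\<close>. The denominator
  \<open>1 - x\<close> is absorbed into the hyperbolic sine, which reduces its positivity to
  \<open>b < sinh b\<close>.\<close>

lemma log_ratio_quotient_deriv:
  assumes "0 < x" "x < 1"
  shows "((\<lambda>x. log_ratio x / sqrt x) has_real_derivative
    (sinh (log_ratio x) - log_ratio x) / (2 * x * sqrt x)) (at x)"
proof -
  have "((\<lambda>x. log_ratio x / sqrt x) has_real_derivative
      (1 / (sqrt x * (1 - x)) * sqrt x - log_ratio x * (inverse (sqrt x) / 2)) / (sqrt x * sqrt x)) (at x)"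
    using assms by (intro DERIV_divide log_ratio_deriv DERIV_real_sqrt) auto
  moreover have "(1 / (sqrt x * (1 - x)) * sqrt x - log_ratio x * (inverse (sqrt x) / 2)) / (sqrt x * sqrt x)
      = (sinh (log_ratio x) - log_ratio x) / (2 * x * sqrt x)"
    using assms unfolding log_ratio_hyperbolic[OF assms] by (simp add: field_simps)
  ultimately show ?thesis by simp
qed

text \<open>\<open>slope_ratio\<close> is the quotient \<open>g'\<^sup>2 / g''\<close> of \<open>jensen_gap_le_max_endpoints\<close> for
  \<open>g = - 4 ln 2 f_ent\<close>. Written in the variable \<open>b = log_ratio x\<close> it is \<open>hyp_ratio\<close>, and its derivative
  in \<open>x\<close> is \<open>- hyp_slope\<close>.\<close>

definition slope_ratio :: "real \<Rightarrow> real" where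
  "slope_ratio x = (log_ratio x / sqrt x)\<^sup>2 / ((sinh (log_ratio x) - log_ratio x) / (2 * x * sqrt x))"

definition hyp_ratio :: "real \<Rightarrow> real" where
  "hyp_ratio b = 2 * b\<^sup>2 * sinh b / ((1 + cosh b) * (sinh b - b))"

definition hyp_slope :: "real \<Rightarrow> real" where
  "hyp_slope b = (1 + cosh b) * b * (b * sinh b * cosh b + b\<^sup>2 - 2 * (sinh b)\<^sup>2) / (sinh b * (sinh b - b)\<^sup>2)"

section \<open>Monotonicity and concavity of the slope ratio\<close>

lemma slope_ratio_eq:
  assumes "0 < x" "x < 1"
  shows "slope_ratio x = hyp_ratio (log_ratio x)"
proof -
  define s b S where "s = sqrt x" and "b = log_ratio x" and "S = sinh b"
  have s: "0 < s" and x: "x = s\<^sup>2" using assms by (auto simp: s_def)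
  have S: "S - b > 0" using sinh_gt_self log_ratio_hyperbolic(1)[OF assms] by (simp add: S_def b_def)
  \<comment> \<open>The half-angle identity
    \<open>tanh (b / 2) = sinh b / (1 + cosh b)\<close>.\<close>
  have sS: "s * (1 + cosh b) = S"
    unfolding S_def b_def log_ratio_hyperbolic[OF assms] using assms by (simp add: s_def field_simps)
  have C: "1 + cosh b > 0" using cosh_real_ge_1[of b] by linarith
  have "slope_ratio x = 2 * b\<^sup>2 * s / (S - b)"
    unfolding slope_ratio_def s_def[symmetric] b_def[symmetric] S_def[symmetric]
    using s S by (simp add: x field_simps power2_eq_square)
  also have "s = S / (1 + cosh b)" using sS C by (simp add: field_simps)
  also have "2 * b\<^sup>2 * (S / (1 + cosh b)) / (S - b) = hyp_ratio b"
    by (simp add: hyp_ratio_def S_def)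
  finally show ?thesis by (simp add: b_def)
qed

text \<open>The factor \<open>2 * sinh b / (1 + cosh b)\<^sup>2\<close> is the derivative of
  \<open>tanh\<^sup>2 (b / 2)\<close>, that is, of \<open>x\<close> with respect to
  \<open>b\<close>. It is split off because it cancels when differentiating with respect to
  \<open>x\<close>.\<close>

lemma hyp_ratio_deriv:
  assumes "0 < b"
  shows "(hyp_ratio has_real_derivative - hyp_slope b * (2 * sinh b / (1 + cosh b)\<^sup>2)) (at b)"
proof -
  define S C where "S = sinh b" and "C = cosh b"
  have S: "S - b > 0" "S > 0" using sinh_gt_self[OF assms] assms by (auto simp: S_def)
  have C: "1 + C > 0" using cosh_real_ge_1[of b] by (simp add: C_def)
  have CC: "C * C = 1 + S * S"
    using cosh_square_eq[of b] by (simp add: power2_eq_square C_def S_def)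
  have CC2: "C * (C * x) = x + S * (S * x)" for x
    by (metis CC mult.assoc distrib_right mult_1)
  define n where "n = (4 * b * S + 2 * b\<^sup>2 * C) * ((1 + C) * (S - b)) - 2 * b\<^sup>2 * S * (S * (S - b) + (1 + C) * (C - 1))"
  define N where "N = b * S * C + b\<^sup>2 - 2 * S\<^sup>2"
  have "(hyp_ratio has_real_derivative n / (((1 + C) * (S - b)) * ((1 + C) * (S - b)))) (at b)"
  proof -
    have "((\<lambda>b. 2 * b\<^sup>2 * sinh b) has_real_derivative 4 * b * S + 2 * b\<^sup>2 * C) (at b)"
      "((\<lambda>b. (1 + cosh b) * (sinh b - b)) has_real_derivative S * (S - b) + (1 + C) * (C - 1)) (at b)"
      by (auto intro!: derivative_eq_intros simp: S_def C_def algebra_simps)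
    from DERIV_divide[OF this] show ?thesis
      using S C by (simp add: hyp_ratio_def[abs_def] n_def S_def C_def)
  qed
  moreover have "n = - (1 + C) * (2 * b * N)"
    unfolding n_def N_def by (simp add: power2_eq_square CC CC2 algebra_simps)
  moreover have "- (1 + C) * (2 * b * N) / (((1 + C) * (S - b)) * ((1 + C) * (S - b)))
      = - ((1 + C) * b * N / (S * (S - b)\<^sup>2)) * (2 * S / (1 + C)\<^sup>2)"
    using S C by (simp add: divide_simps power2_eq_square) (simp add: algebra_simps)
  ultimately show ?thesis
    by (simp add: hyp_slope_def S_def C_def N_def)
qed

lemma hyp_slope_deriv_pos:
  assumes "0 < b"
  shows "\<exists>d. (hyp_slope has_real_derivative d) (at b) \<and> 0 < d"
proof -
  define S C where "S = sinh b" and "C = cosh b"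
  define N N' where "N = b * S * C + b\<^sup>2 - 2 * S\<^sup>2" and "N' = b * (2 * C\<^sup>2 + 1) - 3 * S * C"
  define E where "E = N * (S - b)\<^sup>2 + N' * b * S * (S - b) - 2 * (C - 1) * b * S * N"
  have S: "S - b > 0" "S > 0" using sinh_gt_self[OF assms] assms by (auto simp: S_def)
  have C: "1 + C > 0" using cosh_real_ge_1[of b] by (simp add: C_def)
  have SS: "S\<^sup>2 = (C - 1) * (C + 1)"
    using sinh_square_eq[of b] by (simp add: power2_eq_square C_def S_def algebra_simps)
  have E: "0 < E"
    using hyp_slope_numerator_pos[OF assms] by (simp add: E_def N_def N'_def S_def C_def)
  define n where "n = ((S * b + (1 + C)) * N + (1 + C) * b * N') * (S * (S - b)\<^sup>2)
    - (1 + C) * b * N * (C * (S - b)\<^sup>2 + S * (2 * (S - b) * (C - 1)))"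
  define NN where "NN b = b * sinh b * cosh b + b\<^sup>2 - 2 * (sinh b)\<^sup>2" for b :: real
  have NN: "NN b = N" by (simp add: NN_def N_def S_def C_def)
  have dN: "(NN has_real_derivative N') (at b)"
    unfolding NN_def[abs_def] N'_def S_def C_def
    using cosh_square_eq[of b]
    by (auto intro!: derivative_eq_intros simp: algebra_simps power2_eq_square)
  have "hyp_slope = (\<lambda>b. (1 + cosh b) * b * NN b / (sinh b * (sinh b - b)\<^sup>2))"
    by (simp add: hyp_slope_def NN_def fun_eq_iff)
  moreover have "((\<lambda>b. (1 + cosh b) * b * NN b / (sinh b * (sinh b - b)\<^sup>2)) has_real_derivative
      n / ((S * (S - b)\<^sup>2) * (S * (S - b)\<^sup>2))) (at b)"
  proof -
    have "((\<lambda>b. (1 + cosh b) * b * NN b) has_real_derivative (S * b + (1 + C)) * N + (1 + C) * b * N') (at b)"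
      "((\<lambda>b. sinh b * (sinh b - b)\<^sup>2) has_real_derivative C * (S - b)\<^sup>2 + S * (2 * (S - b) * (C - 1))) (at b)"
      by (auto intro!: derivative_eq_intros dN simp: S_def C_def algebra_simps simp flip: NN)
    from DERIV_divide[OF this] show ?thesis
      using S C by (simp add: n_def S_def C_def NN)
  qed
  moreover have "n = (S - b) * ((1 + C) * E)"
  proof -
    \<comment> \<open>The quotient-rule numerator has the claimed factorisation only modulo
      \<open>SS\<close>; the last factor of this difference is zero.\<close>
    have "n - (S - b) * ((1 + C) * E) = (S - b)\<^sup>2 * N * b * (S\<^sup>2 - (C - 1) * (C + 1))"
      unfolding n_def E_def by (simp add: power2_eq_square algebra_simps)
    then show ?thesis using SS by simp
  qed
  then have "0 < n / ((S * (S - b)\<^sup>2) * (S * (S - b)\<^sup>2))"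
    using S C E by simp
  ultimately show ?thesis by auto
qed

lemma slope_ratio_deriv:
  assumes "0 < x" "x < 1"
  shows "(slope_ratio has_real_derivative - hyp_slope (log_ratio x)) (at x)"
proof -
  define b S C where "b = log_ratio x" and "S = sinh b" and "C = cosh b"
  have b: "0 < b" using log_ratio_hyperbolic(1)[OF assms] by (simp add: b_def)
  have "((\<lambda>x. hyp_ratio (log_ratio x)) has_real_derivative
      - hyp_slope b * (2 * S / (1 + C)\<^sup>2) * (1 / (sqrt x * (1 - x)))) (at x)"
    unfolding b_def S_def C_def
    by (rule DERIV_chain2[OF hyp_ratio_deriv log_ratio_deriv]) (use assms log_ratio_hyperbolic(1) in auto)
  moreover have "(2 * S / (1 + C)\<^sup>2) * (1 / (sqrt x * (1 - x))) = 1"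
  proof -
    have "1 + C = 2 / (1 - x)"
      using assms log_ratio_hyperbolic(3)[OF assms] by (simp add: C_def b_def field_simps)
    moreover have "S = 2 * sqrt x / (1 - x)"
      using log_ratio_hyperbolic(2)[OF assms] by (simp add: S_def b_def)
    ultimately show ?thesis
      using assms by (simp only:) (simp add: divide_simps power2_eq_square)
  qed
  then have "- hyp_slope b * (2 * S / (1 + C)\<^sup>2) * (1 / (sqrt x * (1 - x))) = - hyp_slope b"
    by (simp only: mult.assoc mult_1_right)
  ultimately have "((\<lambda>x. hyp_ratio (log_ratio x)) has_real_derivative - hyp_slope b) (at x)"
    by simp
  then show ?thesis
    unfolding b_def
    \<comment> \<open>The two functions are known to agree only on the open unit interval, which
      suffices for the derivative.\<close>
    by (rule has_field_derivative_transform_within_open[of _ _ _ "{0<..<1}"])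
      (use assms slope_ratio_eq in auto)
qed

lemma hyp_slope_mono:
  assumes "0 < a" "a \<le> b"
  shows "hyp_slope a \<le> hyp_slope b"
proof (rule DERIV_nonneg_imp_nondecreasing[OF assms(2)])
  fix c assume "a \<le> c" "c \<le> b"
  then have "0 < c" using assms by simp
  from hyp_slope_deriv_pos[OF this] show "\<exists>d. (hyp_slope has_real_derivative d) (at c) \<and> 0 \<le> d"
    by (auto intro: less_imp_le)
qed

lemma hyp_slope_pos:
  assumes "0 < b"
  shows "0 < hyp_slope b"
  unfolding hyp_slope_def
  using assms hyperbolic_numerator_pos[OF assms] sinh_gt_self[OF assms] cosh_real_ge_1[of b]
  by (intro divide_pos_pos mult_pos_pos) auto

lemma log_ratio_mono:
  assumes "0 < x" "x \<le> y" "y < 1"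
  shows "log_ratio x \<le> log_ratio y"
proof (rule DERIV_nonneg_imp_nondecreasing[OF assms(2)])
  fix z assume "x \<le> z" "z \<le> y"
  then show "\<exists>d. (log_ratio has_real_derivative d) (at z) \<and> 0 \<le> d"
    using assms by (intro exI[of _ "1 / (sqrt z * (1 - z))"] conjI log_ratio_deriv) auto
qed

lemma slope_ratio_strict_antimono:
  assumes "0 < x" "x < y" "y < 1"
  shows "slope_ratio y < slope_ratio x"
proof (rule DERIV_neg_imp_decreasing[OF assms(2)])
  fix z assume z: "x \<le> z" "z \<le> y"
  then show "\<exists>d. (slope_ratio has_real_derivative d) (at z) \<and> d < 0"
    using assms slope_ratio_deriv[of z] hyp_slope_pos[of "log_ratio z"] log_ratio_hyperbolic(1)[of z]
    by (intro exI[of _ "- hyp_slope (log_ratio z)"]) auto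
qed

lemma slope_ratio_midpoint_concave:
  assumes "0 < x" "x < 1" "0 < y" "y < 1"
  shows "(slope_ratio x + slope_ratio y) / 2 \<le> slope_ratio ((x + y) / 2)"
proof -
  have "convex_on {0<..<1} (\<lambda>x. - slope_ratio x)"
  \<comment> \<open>The derivative of \<open>- slope_ratio\<close> is a composition of two
    nondecreasing functions.\<close>
  proof (rule convex_on_realI[where f' = "\<lambda>x. hyp_slope (log_ratio x)"])
    fix z :: real assume "z \<in> {0<..<1}"
    then show "((\<lambda>x. - slope_ratio x) has_real_derivative hyp_slope (log_ratio z)) (at z)"
      using DERIV_minus[OF slope_ratio_deriv[of z]] by simp
  next
    fix z z' :: real assume "z \<in> {0<..<1}" "z' \<in> {0<..<1}" "z \<le> z'"
    then show "hyp_slope (log_ratio z) \<le> hyp_slope (log_ratio z')"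
      by (intro hyp_slope_mono log_ratio_mono log_ratio_hyperbolic(1)) auto
  qed simp
  from convex_onD[OF this, of "1/2" x y] show ?thesis
    using assms by (simp add: add_divide_distrib)
qed

section \<open>Quasiconvexity of the entropy gap\<close>

text \<open>The arguments stand for the squared Bloch lengths of the two output states and, last, of
  their equal mixture.\<close>

definition entropy_gap :: "real \<times> real \<times> real \<Rightarrow> real" where
  "entropy_gap = (\<lambda>(u, v, w). f_ent w - (f_ent u + f_ent v) / 2)"

text \<open>Squared lengths satisfy the last condition because the squared norm is convex. All
  conditions are linear, so the region is convex.\<close>

definition gap_region :: "(real \<times> real \<times> real) set" where
  "gap_region = {(u, v, w). 0 \<le> u \<and> u \<le> 1 \<and> 0 \<le> v \<and> v \<le> 1 \<and> 0 \<le> w \<and> w \<le> (u + v) / 2}"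

lemma entropy_gap_le_max_open:
  assumes u: "0 < u0" "u0 < 1" "0 < u1" "u1 < 1" and v: "0 < v0" "v0 < 1" "0 < v1" "v1 < 1"
    and w: "0 < w0" "w0 < (u0 + v0) / 2" "0 < w1" "w1 < (u1 + v1) / 2"
    and t: "0 \<le> t" "t \<le> 1"
  shows "entropy_gap (u0 + t * (u1 - u0), v0 + t * (v1 - v0), w0 + t * (w1 - w0))
    \<le> max (entropy_gap (u0, v0, w0)) (entropy_gap (u1, v1, w1))"
proof -
  have pos: "0 < (sinh (log_ratio x) - log_ratio x) / (2 * x * sqrt x)" if "0 < x" "x < 1" for x
    using sinh_gt_self[OF log_ratio_hyperbolic(1)[OF that]] that by simp
  define k :: real where "k = 4 * ln 2"
  have k: "k > 0" by (simp add: k_def)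
  have gap: "entropy_gap (u, v, w) = (((- 4 * ln 2 * f_ent u) + (- 4 * ln 2 * f_ent v)) / 2 - (- 4 * ln 2 * f_ent w)) / k" for u v w
    by (simp add: entropy_gap_def k_def field_simps)
  have max_div: "max (a / k) (b / k) = max a b / k" for a b
    using k by (auto simp: max_def divide_le_cancel)
  show ?thesis
    using jensen_gap_le_max_endpoints[OF f_ent_deriv log_ratio_quotient_deriv _ pos
        slope_ratio_strict_antimono[unfolded slope_ratio_def]
        slope_ratio_midpoint_concave[unfolded slope_ratio_def] u v w t] k log_ratio_hyperbolic(1)
    unfolding gap max_div by (simp add: divide_le_cancel)
qed

section \<open>Continuity and passage to the boundary of the region\<close>

lemma continuous_on_mult_ln: "continuous_on {0..} (\<lambda>y::real. y * ln y)"
  unfolding continuous_on_eq_continuous_within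
proof
  fix y :: real assume y: "y \<in> {0..}"
  show "continuous (at y within {0..}) (\<lambda>y. y * ln y)"
  proof (cases "y = 0")
    case True
    \<comment> \<open>The substitution \<open>y = 1 / x\<close> turns the limit of
      \<open>y * ln y\<close> at 0 into that of \<open>- ln x / x\<close> at infinity; the value at
      0 is 0 because of the factor \<open>y\<close>.\<close>
    have "((\<lambda>x::real. - (ln x / x)) \<longlongrightarrow> - 0) at_top"
      by (intro tendsto_minus ln_x_over_x_tendsto_0)
    moreover have "\<forall>\<^sub>F x in at_top. - (ln x / x) = inverse x * ln (inverse (x::real))"
      using eventually_gt_at_top[of 0] by eventually_elim (simp add: ln_inverse divide_inverse)
    ultimately have "((\<lambda>x::real. inverse x * ln (inverse x)) \<longlongrightarrow> 0) at_top"
      by (simp cong: filterlim_cong)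
    then have "((\<lambda>y::real. y * ln y) \<longlongrightarrow> 0) (at_right 0)"
      by (simp add: filterlim_at_right_to_top)
    then show ?thesis
      using True by (simp add: continuous_within at_within_Ici_at_right)
  next
    case False
    then show ?thesis using y by (auto intro!: continuous_intros)
  qed
qed

lemma continuous_on_f_ent: "continuous_on {0..1} f_ent"
proof -
  have H2: "H2 x = - (x * ln x + (1 - x) * ln (1 - x)) / ln 2" for x
    by (simp add: H2_def log_def field_simps)
  have c1: "continuous_on {0..1} (\<lambda>x. (1 - sqrt x) / 2 * ln ((1 - sqrt x) / 2))"
    by (rule continuous_on_compose2[OF continuous_on_mult_ln]) (auto intro!: continuous_intros)
  have c2: "continuous_on {0..1} (\<lambda>x. (1 - (1 - sqrt x) / 2) * ln (1 - (1 - sqrt x) / 2))"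
    by (rule continuous_on_compose2[OF continuous_on_mult_ln])
      (auto intro!: continuous_intros simp: field_simps add_nonneg_nonneg)
  show ?thesis
    unfolding f_ent_def[abs_def] H2
    by (intro continuous_on_divide continuous_on_minus continuous_on_add c1 c2 continuous_on_const) auto
qed

lemma tendsto_entropy_gap:
  assumes "u \<longlonglongrightarrow> u'" "v \<longlonglongrightarrow> v'" "w \<longlonglongrightarrow> w'"
    and "\<And>n. (u n, v n, w n) \<in> gap_region" "(u', v', w') \<in> gap_region"
  shows "(\<lambda>n. entropy_gap (u n, v n, w n)) \<longlonglongrightarrow> entropy_gap (u', v', w')"
proof -
  have unit: "u n \<in> {0..1}" "v n \<in> {0..1}" "w n \<in> {0..1}" for n
    using assms(4)[of n] by (auto simp: gap_region_def)
  have unit': "u' \<in> {0..1}" "v' \<in> {0..1}" "w' \<in> {0..1}"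
    using assms(5) by (auto simp: gap_region_def)
  show ?thesis
    unfolding entropy_gap_def prod.case using assms(1-3) unit unit'
    by (intro tendsto_intros continuous_on_tendsto_compose[OF continuous_on_f_ent] always_eventually allI)
      auto
qed

lemma convex_gap_region: "convex gap_region"
proof (rule convexI)
  fix P Q and a b :: real
  assume "P \<in> gap_region" "Q \<in> gap_region" and ab: "0 \<le> a" "0 \<le> b" "a + b = 1"
  moreover obtain u0 v0 w0 u1 v1 w1 where PQ: "P = (u0, v0, w0)" "Q = (u1, v1, w1)"
    by (metis prod_cases3)
  ultimately have u: "0 \<le> u0" "u0 \<le> 1" "0 \<le> u1" "u1 \<le> 1" and v: "0 \<le> v0" "v0 \<le> 1" "0 \<le> v1" "v1 \<le> 1"
    and w: "0 \<le> w0" "w0 \<le> (u0 + v0) / 2" "0 \<le> w1" "w1 \<le> (u1 + v1) / 2"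
    by (auto simp: gap_region_def)
  have "a * w0 + b * w1 \<le> a * ((u0 + v0) / 2) + b * ((u1 + v1) / 2)"
    using ab w by (intro add_mono mult_left_mono)
  then show "a *\<^sub>R P + b *\<^sub>R Q \<in> gap_region"
    using ab u v w by (auto simp: gap_region_def PQ algebra_simps add_divide_distrib intro!: convex_bound_le)
qed

text \<open>Shrinking towards \<open>(1/2, 1/2, 1/4)\<close> moves all of the region into the open part, and makes
  \<open>w < (u + v) / 2\<close> strict.\<close>

lemma entropy_gap_le_max:
  assumes P: "(u0, v0, w0) \<in> gap_region" and Q: "(u1, v1, w1) \<in> gap_region"
    and t: "0 \<le> t" "t \<le> 1"
  shows "entropy_gap (u0 + t * (u1 - u0), v0 + t * (v1 - v0), w0 + t * (w1 - w0))
    \<le> max (entropy_gap (u0, v0, w0)) (entropy_gap (u1, v1, w1))"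
proof -
  define e where "e n = inverse (real (Suc n)) / 3" for n
  have e: "0 < e n" "e n < 1/2" for n
    by (auto simp: e_def field_simps)
  have e0: "e \<longlonglongrightarrow> 0"
    unfolding e_def[abs_def] using tendsto_divide[OF LIMSEQ_inverse_real_of_nat tendsto_const, of 3] by simp
  \<comment> \<open>These move a point by the fraction \<open>2 * e n\<close> towards 1/2 and 1/4
    respectively. The different additive terms leave a margin of at least \<open>e n / 2\<close> in
    \<open>kh\<close>.\<close>
  define h k where "h n x = (1 - 2 * e n) * x + e n" and "k n x = (1 - 2 * e n) * x + e n / 2" for n and x :: real
  have h: "0 < h n x \<and> h n x < 1" if "0 \<le> x" "x \<le> 1" for n x
  proof -
    have "0 \<le> (1 - 2 * e n) * x" "(1 - 2 * e n) * x \<le> 1 - 2 * e n"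
      using that e[of n] by (auto intro: mult_left_le)
    then show ?thesis using e[of n] unfolding h_def by linarith
  qed
  have k: "0 < k n x" if "0 \<le> x" for n x
    using that e[of n] by (auto simp: k_def intro!: add_nonneg_pos)
  have kh: "k n z < (h n x + h n y) / 2" if "z \<le> (x + y) / 2" for n x y z
  proof -
    have "(1 - 2 * e n) * z \<le> (1 - 2 * e n) * ((x + y) / 2)"
      using that e[of n] by (intro mult_left_mono) auto
    then show ?thesis
      using e[of n] by (simp add: h_def k_def algebra_simps add_divide_distrib)
  qed
  have hk_lim: "(\<lambda>n. h n x) \<longlonglongrightarrow> x" "(\<lambda>n. k n x) \<longlonglongrightarrow> x" for x
    unfolding h_def k_def using e0 by (auto intro!: tendsto_eq_intros)
  have open': "(h n u, h n v, k n w) \<in> gap_region" if "(u, v, w) \<in> gap_region" for n u v w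
    using that h[of u n] h[of v n] k[of w n] kh[of w u v n] by (auto simp: gap_region_def intro: less_imp_le)
  have mid: "(u0 + t * (u1 - u0), v0 + t * (v1 - v0), w0 + t * (w1 - w0)) \<in> gap_region"
    if "(u0, v0, w0) \<in> gap_region" "(u1, v1, w1) \<in> gap_region" for u0 v0 w0 u1 v1 w1
    using convexD[OF convex_gap_region that, of "1 - t" t] t by (simp add: algebra_simps)
  \<comment> \<open>The open case applies to the shrunken end points; both sides then converge by
    continuity of the gap.\<close>
  have "entropy_gap (h n u0 + t * (h n u1 - h n u0), h n v0 + t * (h n v1 - h n v0), k n w0 + t * (k n w1 - k n w0))
    \<le> max (entropy_gap (h n u0, h n v0, k n w0)) (entropy_gap (h n u1, h n v1, k n w1))" for n
    using h[of u0 n] h[of u1 n] h[of v0 n] h[of v1 n] k[of w0 n] k[of w1 n]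
      kh[of w0 u0 v0 n] kh[of w1 u1 v1 n] P Q t
    by (intro entropy_gap_le_max_open) (simp_all add: gap_region_def)
  moreover have "(\<lambda>n. entropy_gap (h n u0 + t * (h n u1 - h n u0), h n v0 + t * (h n v1 - h n v0), k n w0 + t * (k n w1 - k n w0)))
    \<longlonglongrightarrow> entropy_gap (u0 + t * (u1 - u0), v0 + t * (v1 - v0), w0 + t * (w1 - w0))"
    by (intro tendsto_entropy_gap mid open' P Q tendsto_intros hk_lim)
  moreover have "(\<lambda>n. max (entropy_gap (h n u0, h n v0, k n w0)) (entropy_gap (h n u1, h n v1, k n w1)))
    \<longlonglongrightarrow> max (entropy_gap (u0, v0, w0)) (entropy_gap (u1, v1, w1))"
    by (intro tendsto_max tendsto_entropy_gap open' P Q hk_lim)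
  ultimately show ?thesis
    by (intro LIMSEQ_le) auto
qed

section \<open>Sign of the gap and extension from segments to the simplex\<close>

lemma f_ent_antimono:
  assumes "0 \<le> x" "x \<le> y" "y \<le> 1"
  shows "f_ent y \<le> f_ent x"
proof (cases "x = y")
  case False
  have "- 4 * ln 2 * f_ent x < - 4 * ln 2 * f_ent y"
  proof (rule DERIV_pos_imp_increasing_open[where f = "\<lambda>x. - 4 * ln 2 * f_ent x"])
    fix z assume "x < z" "z < y"
    then show "\<exists>d. ((\<lambda>x. - 4 * ln 2 * f_ent x) has_real_derivative d) (at z) \<and> 0 < d"
      using assms f_ent_deriv[of z] log_ratio_hyperbolic(1)[of z] by (intro exI[of _ "log_ratio z / sqrt z"]) auto
  qed (use assms False in \<open>auto intro!: continuous_intros continuous_on_subset[OF continuous_on_f_ent]\<close>)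
  then show ?thesis by simp
qed simp

lemma f_ent_midpoint:
  assumes "0 \<le> x" "x \<le> 1" "0 \<le> y" "y \<le> 1"
  shows "(f_ent x + f_ent y) / 2 \<le> f_ent ((x + y) / 2)"
proof -
  have less: "(f_ent x + f_ent y) / 2 \<le> f_ent ((x + y) / 2)" if xy: "0 \<le> x" "x < y" "y \<le> 1" for x y
  proof -
    define m where "m = (x + y) / 2"
    have m: "x < m" "m < y" using xy by (auto simp: m_def)
    define g where "g x = - 4 * ln 2 * f_ent x" for x
    \<comment> \<open>The derivative formula covers only the open interval, while \<open>x\<close>
      may be 0 and \<open>y\<close> may be 1. The mean value theorem needs mere continuity at the
      end points; comparing the slopes on the two halves gives midpoint convexity of
      \<open>g\<close>.\<close>
    have mvt: "\<exists>z. a < z \<and> z < b \<and> g b - g a = (b - a) * (log_ratio z / sqrt z)"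
      if ab: "0 \<le> a" "a < b" "b \<le> 1" for a b
    proof -
      have "continuous_on {a..b} g"
        unfolding g_def using ab by (auto intro!: continuous_intros continuous_on_subset[OF continuous_on_f_ent])
      moreover have dg: "(g has_real_derivative log_ratio z / sqrt z) (at z)" if "a < z" "z < b" for z
        unfolding g_def using ab that by (intro f_ent_deriv) auto
      ultimately obtain l z where z: "a < z" "z < b" "(g has_real_derivative l) (at z)" "g b - g a = (b - a) * l"
        using MVT[OF ab(2), of g] real_differentiable_def by blast
      then have "l = log_ratio z / sqrt z" using DERIV_unique dg by blast
      then show ?thesis using z by blast
    qed
    obtain z1 where z1: "x < z1" "z1 < m" "g m - g x = (m - x) * (log_ratio z1 / sqrt z1)"
      using mvt[of x m] xy m by auto
    obtain z2 where z2: "m < z2" "z2 < y" "g y - g m = (y - m) * (log_ratio z2 / sqrt z2)"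
      using mvt[of m y] xy m by auto
    have "log_ratio z1 / sqrt z1 \<le> log_ratio z2 / sqrt z2"
    proof (rule DERIV_nonneg_imp_nondecreasing[where f = "\<lambda>x. log_ratio x / sqrt x"])
      fix z assume "z1 \<le> z" "z \<le> z2"
      then have z: "0 < z" "z < 1" using xy z1 z2 by auto
      then have "0 \<le> (sinh (log_ratio z) - log_ratio z) / (2 * z * sqrt z)"
        using sinh_gt_self[OF log_ratio_hyperbolic(1)[OF z]] by simp
      then show "\<exists>d. ((\<lambda>x. log_ratio x / sqrt x) has_real_derivative d) (at z) \<and> 0 \<le> d"
        using log_ratio_quotient_deriv[OF z] by blast
    qed (use z1 z2 in auto)
    then have "(y - x) / 2 * (log_ratio z1 / sqrt z1) \<le> (y - x) / 2 * (log_ratio z2 / sqrt z2)"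
      using xy by (intro mult_left_mono) auto
    moreover have "m - x = (y - x) / 2" "y - m = (y - x) / 2"
      by (auto simp: m_def field_simps)
    ultimately have "g m - g x \<le> g y - g m"
      unfolding z1(3) z2(3) by (simp only:)
    then have "4 * ln 2 * (f_ent x + f_ent y) \<le> 4 * ln 2 * (2 * f_ent m)"
      by (simp add: g_def algebra_simps)
    then show ?thesis by (simp add: m_def)
  qed
  consider "x < y" | "x = y" | "y < x" by linarith
  then show ?thesis
    using less[of x y] less[of y x] assms by cases (auto simp: add.commute)
qed

text \<open>Concavity of \<open>f_ent\<close> handles \<open>w = (u + v) / 2\<close>, and lowering
  \<open>w\<close> only increases the gap. This is what keeps the vertex 0 of the simplex, where the
  gap is 0, from exceeding the other vertices.\<close>

lemma entropy_gap_nonneg: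
  assumes "P \<in> gap_region"
  shows "0 \<le> entropy_gap P"
proof -
  obtain u v w where P: "P = (u, v, w)" by (metis prod_cases3)
  have "(f_ent u + f_ent v) / 2 \<le> f_ent ((u + v) / 2)"
    using assms by (intro f_ent_midpoint) (auto simp: P gap_region_def)
  also have "\<dots> \<le> f_ent w"
    using assms by (intro f_ent_antimono) (auto simp: P gap_region_def)
  finally show ?thesis by (simp add: P entropy_gap_def)
qed

text \<open>Quasiconvexity phrased as convexity of a set, which gives access to convex combinations
  of more than two points.\<close>

lemma convex_entropy_gap_sublevel: "convex {P \<in> gap_region. entropy_gap P \<le> m}"
  unfolding convex_alt
proof (intro ballI allI impI)
  fix P Q and t :: real
  assume *: "P \<in> {P \<in> gap_region. entropy_gap P \<le> m}" "Q \<in> {P \<in> gap_region. entropy_gap P \<le> m}" "0 \<le> t \<and> t \<le> 1"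
  obtain u0 v0 w0 u1 v1 w1 where PQ: "P = (u0, v0, w0)" "Q = (u1, v1, w1)"
    by (metis prod_cases3)
  have "(1 - t) *\<^sub>R P + t *\<^sub>R Q = (u0 + t * (u1 - u0), v0 + t * (v1 - v0), w0 + t * (w1 - w0))"
    by (simp add: PQ algebra_simps)
  then have "entropy_gap ((1 - t) *\<^sub>R P + t *\<^sub>R Q) \<le> max (entropy_gap P) (entropy_gap Q)"
    using entropy_gap_le_max[of u0 v0 w0 u1 v1 w1 t] * PQ by simp
  moreover have "(1 - t) *\<^sub>R P + t *\<^sub>R Q \<in> gap_region"
    using convexD_alt[OF convex_gap_region] * by auto
  ultimately show "(1 - t) *\<^sub>R P + t *\<^sub>R Q \<in> {P \<in> gap_region. entropy_gap P \<le> m}"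
    using * by auto
qed

text \<open>The missing weight \<open>1 - sum x I\<close> is put on the origin; the remaining
  weights are first normalised to sum 1, unless they all vanish.\<close>

lemma convex_sub_sum_mem:
  assumes "convex S" "0 \<in> S" "finite I" "\<And>i. i \<in> I \<Longrightarrow> 0 \<le> x i" "sum x I \<le> (1::real)"
    and "\<And>i. i \<in> I \<Longrightarrow> P i \<in> S"
  shows "(\<Sum>i\<in>I. x i *\<^sub>R P i) \<in> S"
proof (cases "sum x I = 0")
  case True
  then have "x i = 0" if "i \<in> I" for i
    using assms that by (simp add: sum_nonneg_eq_0_iff)
  then show ?thesis using assms(2) by simp
next
  case False
  define s where "s = sum x I"
  have s: "0 < s" "s \<le> 1"
    using False assms sum_nonneg[of I x] by (auto simp: s_def)
  have "(\<Sum>i\<in>I. (x i / s) *\<^sub>R P i) \<in> S"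
  proof (rule convex_sum[OF assms(3,1)])
    show "(\<Sum>i\<in>I. x i / s) = 1" using s by (simp add: s_def flip: sum_divide_distrib)
  qed (use assms s in auto)
  from convexD[OF assms(1) this assms(2), of s "1 - s"] s
  have "s *\<^sub>R (\<Sum>i\<in>I. (x i / s) *\<^sub>R P i) \<in> S" by simp
  then show ?thesis using s by (simp add: scaleR_sum_right)
qed

lemma entropy_gap_le_vertices:
  assumes "finite I" "I \<noteq> {}" "\<And>i. i \<in> I \<Longrightarrow> 0 \<le> x i" "sum x I \<le> 1"
    and P: "\<And>i. i \<in> I \<Longrightarrow> P i \<in> gap_region" and m: "\<And>i. i \<in> I \<Longrightarrow> entropy_gap (P i) \<le> m"
  shows "entropy_gap (\<Sum>i\<in>I. x i *\<^sub>R P i) \<le> m"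
proof -
  have "0 \<le> m" using assms(2) P m entropy_gap_nonneg by (meson all_not_in_conv order_trans)
  then have "0 \<in> {P \<in> gap_region. entropy_gap P \<le> m}"
    by (auto simp: gap_region_def entropy_gap_def zero_prod_def)
  from convex_sub_sum_mem[OF convex_entropy_gap_sublevel this assms(1,3,4), of P] P m
  show ?thesis by simp
qed

section \<open>Qubit states and Bloch vectors\<close>

lemma vn_entropy_diagonalised:
  fixes d :: "real^'n" and \<rho> :: "complex^'n^'n"
  assumes U: "unitary_matrix U" and \<rho>: "\<rho> = U ** diag_matrix (\<chi> i. of_real (d $ i)) ** cadjoint U"
  shows "vn_entropy \<rho> = - (\<Sum>i\<in>UNIV. d $ i * log 2 (d $ i))"
proof -
  define D L :: "complex^'n^'n" where "D = diag_matrix (\<chi> i. of_real (d $ i))"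
    and "L = diag_matrix (\<chi> i. of_real (log 2 (d $ i)))"
  have UU: "cadjoint U ** U = mat 1" using U by (simp add: unitary_matrix_def)
  have "\<rho> ** herm_fun (log 2) \<rho> = U ** D ** cadjoint U ** (U ** L ** cadjoint U)"
    using herm_fun_eq[OF U \<rho>, of "log 2"] by (simp add: \<rho> D_def L_def)
  also have "\<dots> = U ** (D ** (cadjoint U ** U) ** L ** cadjoint U)"
    by (simp add: matrix_mul_assoc)
  \<comment> \<open>Cyclicity of the trace moves the outer \<open>U\<close> to the end, where it
    meets its adjoint.\<close>
  also have "trace \<dots> = trace (D ** L ** cadjoint U ** U)"
    by (simp add: trace_mul_sym[of U] UU)
  also have "\<dots> = trace (D ** L)"
    by (simp add: UU flip: matrix_mul_assoc)
  also have "\<dots> = (\<Sum>i\<in>UNIV. of_real (d $ i * log 2 (d $ i)))"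
    by (simp add: trace_def D_def L_def diag_matrix_mult_left) (simp add: diag_matrix_def)
  finally show ?thesis
    by (simp add: vn_entropy_def)
qed

text \<open>In spherical coordinates, \<open>A\<close> is the cosine of half the polar angle, and
  \<open>B\<close>, \<open>D\<close> are the real and imaginary parts of its sine times the
  azimuthal phase. At the south pole the phase is arbitrary.\<close>

lemma unit_vector_half_angle:
  fixes n1 n2 n3 :: real
  assumes "n1\<^sup>2 + n2\<^sup>2 + n3\<^sup>2 = 1"
  obtains A B D where "A\<^sup>2 + B\<^sup>2 + D\<^sup>2 = 1" "n3 = A\<^sup>2 - B\<^sup>2 - D\<^sup>2" "n1 = 2 * A * B" "n2 = 2 * A * D"
proof (cases "n3 = -1")
  case True
  then have "n1\<^sup>2 + n2\<^sup>2 = 0" using assms by simp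
  then have "n1 = 0" "n2 = 0" by (simp_all add: sum_power2_eq_zero_iff)
  then show ?thesis using that[of 0 1 0] True by simp
next
  case False
  have "n3\<^sup>2 \<le> 1" using assms sum_power2_ge_zero[of n1 n2] by linarith
  then have n3: "1 + n3 > 0" using False by (simp add: abs_square_le_1 abs_le_iff)
  \<comment> \<open>The vector \<open>(1 + n3, n1, n2)\<close> has squared length
    \<open>2 * (1 + n3)\<close>, so \<open>k\<close> normalises it.\<close>
  define k where "k = 1 / sqrt (2 * (1 + n3))"
  have k: "k\<^sup>2 * (2 * (1 + n3)) = 1" using n3 by (simp add: k_def power_divide)
  have n12: "n1\<^sup>2 + n2\<^sup>2 = (1 - n3) * (1 + n3)" using assms by (simp add: power2_eq_square algebra_simps)
  have "(k * (1 + n3))\<^sup>2 + (k * n1)\<^sup>2 + (k * n2)\<^sup>2 = k\<^sup>2 * ((1 + n3)\<^sup>2 + (n1\<^sup>2 + n2\<^sup>2))"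
    unfolding power_mult_distrib by (simp only: distrib_left add.assoc)
  also have "\<dots> = k\<^sup>2 * (2 * (1 + n3))"
    unfolding n12 by (simp add: power2_eq_square algebra_simps)
  finally have 1: "(k * (1 + n3))\<^sup>2 + (k * n1)\<^sup>2 + (k * n2)\<^sup>2 = 1" using k by simp
  have "(k * (1 + n3))\<^sup>2 - (k * n1)\<^sup>2 - (k * n2)\<^sup>2 = k\<^sup>2 * ((1 + n3)\<^sup>2 - (n1\<^sup>2 + n2\<^sup>2))"
    unfolding power_mult_distrib by (simp only: right_diff_distrib distrib_left diff_diff_eq)
  also have "\<dots> = n3 * (k\<^sup>2 * (2 * (1 + n3)))"
    unfolding n12 by (simp add: power2_eq_square algebra_simps)
  finally have 2: "n3 = (k * (1 + n3))\<^sup>2 - (k * n1)\<^sup>2 - (k * n2)\<^sup>2" using k by simp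
  have 3: "x = 2 * (k * (1 + n3)) * (k * x)" for x
  proof -
    have "2 * (k * (1 + n3)) * (k * x) = (k\<^sup>2 * (2 * (1 + n3))) * x"
      by (simp add: power2_eq_square)
    then show ?thesis using k by simp
  qed
  show ?thesis by (rule that[OF 1 2 3 3])
qed

lemma bloch_state_diagonalisation:
  fixes n :: "real^3"
  assumes "(n $ 1)\<^sup>2 + (n $ 2)\<^sup>2 + (n $ 3)\<^sup>2 = 1"
  obtains U where "unitary_matrix U"
    "\<And>s. bloch_state (s *\<^sub>R n) = U ** diag_matrix (\<chi> i. of_real ((vector [(1 + s) / 2, (1 - s) / 2] :: real^2) $ i)) ** cadjoint U"
proof -
  obtain A B D where abd: "A\<^sup>2 + B\<^sup>2 + D\<^sup>2 = 1" and n: "n $ 3 = A\<^sup>2 - B\<^sup>2 - D\<^sup>2" "n $ 1 = 2 * A * B" "n $ 2 = 2 * A * D"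
    using unit_vector_half_angle[OF assms] by metis
  have AA: "A * A = 1 - B * B - D * D" using abd by (simp add: power2_eq_square)
  have AA': "A * (A * x) = x - B * (B * x) - D * (D * x)" for x
    using arg_cong[OF AA, of "\<lambda>y. y * x"] by (simp add: algebra_simps)
  \<comment> \<open>The columns are the spin-up and spin-down eigenvectors along \<open>n\<close>;
    they depend on the direction only, so one \<open>U\<close> serves every length
    \<open>s\<close>.\<close>
  define U :: "complex^2^2" where
    "U = vector [vector [Complex A 0, Complex (- B) D], vector [Complex B D, Complex A 0]]"
  have "unitary_matrix U"
    by (simp add: unitary_matrix_def cadjoint_def U_def mat_def vec_eq_iff forall_2
        matrix_matrix_mult_def sum_2 complex_eq_iff AA algebra_simps)
  moreover have "bloch_state (s *\<^sub>R n) = U ** diag_matrix (\<chi> i. of_real ((vector [(1 + s) / 2, (1 - s) / 2] :: real^2) $ i)) ** cadjoint U" for s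
    by (simp add: bloch_state_def pauli_def diag_matrix_def cadjoint_def U_def vec_eq_iff forall_2
        matrix_matrix_mult_def sum_2 complex_eq_iff n power2_eq_square)
      (simp add: AA AA' field_simps)
  ultimately show ?thesis using that by blast
qed

lemma norm_vec3_square: "(norm r)\<^sup>2 = (r $ 1)\<^sup>2 + (r $ 2)\<^sup>2 + (r $ 3)\<^sup>2" for r :: "real^3"
  unfolding power2_norm_eq_inner by (simp add: inner_vec_def sum_3 power2_eq_square)

lemma vn_entropy_bloch_state: "vn_entropy (bloch_state r) = f_ent ((norm r)\<^sup>2)"
proof -
  obtain n where n: "norm n = 1" "r = norm r *\<^sub>R n"
  proof (cases "r = 0")
    case True
    \<comment> \<open>The zero vector has no direction of its own; any unit vector will do.\<close>
    then show ?thesis using that[of "axis 1 1"] by simp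
  next
    case False
    then show ?thesis using that[of "r /\<^sub>R norm r"] by simp
  qed
  have "(n $ 1)\<^sup>2 + (n $ 2)\<^sup>2 + (n $ 3)\<^sup>2 = 1"
    using n(1) norm_vec3_square[of n] by simp
  then obtain U where "unitary_matrix U"
    "bloch_state (norm r *\<^sub>R n) = U ** diag_matrix (\<chi> i. of_real ((vector [(1 + norm r) / 2, (1 - norm r) / 2] :: real^2) $ i)) ** cadjoint U"
    using bloch_state_diagonalisation by metis
  from vn_entropy_diagonalised[OF this] have vn:
    "vn_entropy (bloch_state r) = - ((1 + norm r) / 2 * log 2 ((1 + norm r) / 2) + (1 - norm r) / 2 * log 2 ((1 - norm r) / 2))"
    using n(2) by (simp add: sum_2)
  have e: "1 - (1 - norm r) / 2 = (1 + norm r) / 2" by (simp add: field_simps)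
  show ?thesis
    unfolding vn f_ent_def H2_def real_sqrt_abs abs_norm_cancel e by simp
qed

section \<open>Positivity and the Bloch ball\<close>

lemma bloch_state_quadratic_form:
  fixes v :: "complex^2"
  shows "Re (\<Sum>i\<in>UNIV. cnj (v $ i) * (bloch_state r *v v) $ i) =
    ((1 + r $ 3) * ((Re (v $ 1))\<^sup>2 + (Im (v $ 1))\<^sup>2) + (1 - r $ 3) * ((Re (v $ 2))\<^sup>2 + (Im (v $ 2))\<^sup>2)) / 2
    + r $ 1 * (Re (v $ 1) * Re (v $ 2) + Im (v $ 1) * Im (v $ 2))
    + r $ 2 * (Re (v $ 1) * Im (v $ 2) - Im (v $ 1) * Re (v $ 2))"
  by (simp add: bloch_state_def pauli_def sum_2 matrix_vector_mult_def power2_eq_square field_simps)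

lemma bloch_state_hermitian: "hermitian_matrix (bloch_state r)"
  by (simp add: hermitian_matrix_def cadjoint_def bloch_state_def pauli_def vec_eq_iff forall_2 complex_eq_iff)

lemma trace_bloch_state: "trace (bloch_state r) = 1"
  by (simp add: trace_def sum_2 bloch_state_def pauli_def complex_eq_iff field_simps)

lemma bloch_state_axis_density: "bloch_state (axis i 1) \<in> density_matrices"
proof -
  have "0 \<le> Re (\<Sum>j\<in>UNIV. cnj (v $ j) * (bloch_state (axis i 1) *v v) $ j)" for v :: "complex^2"
  proof -
    define a b c d where "a = Re (v $ 1)" and "b = Im (v $ 1)" and "c = Re (v $ 2)" and "d = Im (v $ 2)"
    \<comment> \<open>Twice the quadratic form for the first and the second axis; for the third axis
      the form is \<open>a\<^sup>2 + b\<^sup>2\<close>.\<close>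
    have "0 \<le> (a + c)\<^sup>2 + (b + d)\<^sup>2" "0 \<le> (a + d)\<^sup>2 + (c - b)\<^sup>2" by auto
    moreover have "i = 1 \<or> i = 2 \<or> i = 3" by (rule exhaust_3)
    ultimately show ?thesis
      unfolding bloch_state_quadratic_form a_def[symmetric] b_def[symmetric] c_def[symmetric] d_def[symmetric]
      by (auto simp: axis_def power2_eq_square field_simps)
  qed
  then show ?thesis
    by (simp add: density_matrices_def psd_matrix_def bloch_state_hermitian trace_bloch_state)
qed

lemma density_matrix_bloch:
  assumes "\<rho> \<in> density_matrices"
  obtains r where "\<rho> = bloch_state r" "norm r \<le> 1"
proof -
  define r :: "real^3" where
    "r = vector [2 * Re (\<rho> $ 1 $ 2), - 2 * Im (\<rho> $ 1 $ 2), Re (\<rho> $ 1 $ 1) - Re (\<rho> $ 2 $ 2)]"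
  have herm: "cnj (\<rho> $ j $ i) = \<rho> $ i $ j" for i j
    using assms by (auto simp: density_matrices_def psd_matrix_def hermitian_matrix_def cadjoint_def vec_eq_iff)
  have "Re (\<rho> $ 1 $ 1) + Re (\<rho> $ 2 $ 2) = 1"
    using assms by (simp add: density_matrices_def trace_def sum_2 complex_eq_iff)
  then have "Re (\<rho> $ 2 $ 2) = 1 - Re (\<rho> $ 1 $ 1)" by simp
  moreover have "Im (\<rho> $ 1 $ 1) = 0" "Im (\<rho> $ 2 $ 2) = 0"
    "Re (\<rho> $ 2 $ 1) = Re (\<rho> $ 1 $ 2)" "Im (\<rho> $ 2 $ 1) = - Im (\<rho> $ 1 $ 2)"
    using herm[of 1 1] herm[of 2 2] herm[of 2 1] by (auto simp: complex_eq_iff)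
  ultimately have \<rho>: "\<rho> = bloch_state r"
    by (simp add: bloch_state_def pauli_def r_def vec_eq_iff forall_2 complex_eq_iff)
  have psd: "0 \<le> Re (\<Sum>i\<in>UNIV. cnj (v $ i) * (bloch_state r *v v) $ i)" for v
    using assms by (simp add: density_matrices_def psd_matrix_def \<rho>)
  define x y z s where "x = r $ 1" and "y = r $ 2" and "z = r $ 3" and "s = norm r"
  have s: "s\<^sup>2 = x\<^sup>2 + y\<^sup>2 + z\<^sup>2" "0 \<le> s"
    by (auto simp: norm_vec3_square x_def y_def z_def s_def)
  have "z\<^sup>2 \<le> s\<^sup>2" using s by simp
  then have zs: "- z \<le> s" using s(2) abs_le_square_iff[of z s] by simp
  have "s \<le> 1"
  proof (cases "s + z = 0 \<or> s = 0")
    case True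
    \<comment> \<open>In the case \<open>s = - z\<close> this is the claim itself.\<close>
    have "0 \<le> 1 + z" using psd[of "vector [1, 0]"] unfolding bloch_state_quadratic_form by (simp add: z_def)
    then show ?thesis using True by auto
  next
    case False
    then have pos: "0 < s + z" "0 < s" using zs s by auto
    \<comment> \<open>The test vector \<open>(x - i y, - (s + z))\<close> is an unnormalised
      eigenvector for the smaller eigenvalue \<open>(1 - s) / 2\<close>, so positivity forces
      \<open>s \<le> 1\<close>. It degenerates to 0 exactly when \<open>s + z = 0\<close>, hence the
      case split.\<close>
    have "0 \<le> ((1 + z) * (x\<^sup>2 + y\<^sup>2) + (1 - z) * (s + z)\<^sup>2) / 2 - x * (x * (s + z)) - y * (y * (s + z))"
      using psd[of "vector [Complex x (- y), Complex (- (s + z)) 0]"]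
      unfolding bloch_state_quadratic_form
      by (simp add: x_def[symmetric] y_def[symmetric] z_def[symmetric] power2_eq_square algebra_simps)
    also have "\<dots> = ((1 + z) * (x\<^sup>2 + y\<^sup>2) + (1 - z) * (s + z)\<^sup>2) / 2 - (x\<^sup>2 + y\<^sup>2) * (s + z)"
      by (simp add: power2_eq_square algebra_simps)
    also have "x\<^sup>2 + y\<^sup>2 = (s - z) * (s + z)"
      using s by (simp add: power2_eq_square algebra_simps)
    also have "((1 + z) * ((s - z) * (s + z)) + (1 - z) * (s + z)\<^sup>2) / 2 - (s - z) * (s + z) * (s + z)
      = (s * (s + z)) * (1 - s)"
      by (simp add: power2_eq_square field_simps)
    finally show ?thesis
      using mult_pos_neg[of "s * (s + z)" "1 - s"] mult_pos_pos[OF pos(2,1)] by linarith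
  qed
  then show ?thesis using that \<rho> by (simp add: s_def)
qed

lemma bloch_state_midpoint: "(1/2) *\<^sub>R (bloch_state a + bloch_state b) = bloch_state ((1/2) *\<^sub>R (a + b))"
  by (simp add: bloch_state_def vec_eq_iff complex_eq_iff field_simps)

lemma QJSD_bloch_state:
  "QJSD (bloch_state a) (bloch_state b) =
    entropy_gap ((norm a)\<^sup>2, (norm b)\<^sup>2, (norm ((1/2) *\<^sub>R (a + b)))\<^sup>2)"
  unfolding QJSD_def bloch_state_midpoint vn_entropy_bloch_state entropy_gap_def by (simp add: field_simps)

section \<open>The divergence of two Pauli channels\<close>

lemma distortion_entry_bounded:
  assumes "prob_vector4 p" and "distortion_matrix p = diag_matrix c"
  shows "\<bar>c $ i\<bar> \<le> 1"
proof -
  have s: "{..<4::nat} = {0, 1, 2, 3}" by auto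
  have p: "0 \<le> p 0" "0 \<le> p 1" "0 \<le> p 2" "0 \<le> p 3" "p 0 + p 1 + p 2 + p 3 = 1"
    using assms(1) by (simp_all add: prob_vector4_def s)
  have c: "c $ i = distortion_matrix p $ i $ i"
    by (simp add: assms(2) diag_matrix_def)
  consider "i = 1" | "i = 2" | "i = 3" using exhaust_3[of i] by blast
  then show ?thesis
    unfolding c abs_le_iff by cases (use p in \<open>simp_all add: distortion_matrix_def diag_matrix_def\<close>)
qed

lemma diag_matrix_vector_mult: "(diag_matrix c *v r) $ i = c $ i * r $ i"
  for c :: "real^'n"
  by (simp add: diag_matrix_def matrix_vector_mult_def if_distrib[of "\<lambda>x. x * _"] cong: if_cong)

theorem proposition2:
  fixes p q :: "nat \<Rightarrow> real" and c\<^sub>p c\<^sub>q :: "real^3"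
  assumes "prob_vector4 p" and "prob_vector4 q"
    and "distortion_matrix p = diag_matrix c\<^sub>p"
    and "distortion_matrix q = diag_matrix c\<^sub>q"
  shows "ent_div1 (pauli_channel p) (pauli_channel q) =
    (MAX i. sqrt (f_ent (((c\<^sub>p $ i + c\<^sub>q $ i) / 2)\<^sup>2)
      - 1/2 * (f_ent ((c\<^sub>p $ i)\<^sup>2) + f_ent ((c\<^sub>q $ i)\<^sup>2))))"
proof -
  \<comment> \<open>The triple belonging to the pure input state on the \<open>i\<close>-th Bloch
    axis. A general input yields the combination of these with weights
    \<open>(r $ i)\<^sup>2\<close>, whose sum is at most 1.\<close>
  define P where "P i = ((c\<^sub>p $ i)\<^sup>2, (c\<^sub>q $ i)\<^sup>2, ((c\<^sub>p $ i + c\<^sub>q $ i) / 2)\<^sup>2)" for i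
  have gap: "entropy_gap (P i) = f_ent (((c\<^sub>p $ i + c\<^sub>q $ i) / 2)\<^sup>2) - 1/2 * (f_ent ((c\<^sub>p $ i)\<^sup>2) + f_ent ((c\<^sub>q $ i)\<^sup>2))" for i
    by (simp add: P_def entropy_gap_def)
  have QJSD: "QJSD (pauli_channel p (bloch_state r)) (pauli_channel q (bloch_state r))
    = entropy_gap (\<Sum>i\<in>UNIV. (r $ i)\<^sup>2 *\<^sub>R P i)" for r
  proof -
    have "(norm (diag_matrix c *v r))\<^sup>2 = (\<Sum>i\<in>UNIV. (r $ i)\<^sup>2 * (c $ i)\<^sup>2)" for c :: "real^3"
      by (simp add: norm_vec3_square diag_matrix_vector_mult sum_3 power_mult_distrib mult.commute)
    moreover have "(norm ((1/2) *\<^sub>R (diag_matrix c\<^sub>p *v r + diag_matrix c\<^sub>q *v r)))\<^sup>2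
        = (\<Sum>i\<in>UNIV. (r $ i)\<^sup>2 * ((c\<^sub>p $ i + c\<^sub>q $ i) / 2)\<^sup>2)"
      unfolding norm_vec3_square sum_3
      by (simp add: diag_matrix_vector_mult power2_eq_square field_simps)
    ultimately show ?thesis
      unfolding pauli_channel_bloch_state[OF assms(1)] pauli_channel_bloch_state[OF assms(2)] assms(3,4) QJSD_bloch_state
      by (simp add: P_def sum_3)
  qed
  have P: "P i \<in> gap_region" for i
  proof -
    have "(c\<^sub>p $ i)\<^sup>2 \<le> 1" "(c\<^sub>q $ i)\<^sup>2 \<le> 1"
      using distortion_entry_bounded[OF assms(1,3), of i] distortion_entry_bounded[OF assms(2,4), of i]
      by (simp_all add: abs_square_le_1)
    moreover have "((c\<^sub>p $ i + c\<^sub>q $ i) / 2)\<^sup>2 \<le> ((c\<^sub>p $ i)\<^sup>2 + (c\<^sub>q $ i)\<^sup>2) / 2"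
      using zero_le_power2[of "c\<^sub>p $ i - c\<^sub>q $ i"] by (simp add: power2_eq_square field_simps)
    ultimately show ?thesis by (simp add: gap_region_def P_def)
  qed
  have "Max (range (\<lambda>i. entropy_gap (P i))) \<in> range (\<lambda>i. entropy_gap (P i))"
    by (intro Max_in) auto
  then obtain m where "Max (range (\<lambda>i. entropy_gap (P i))) = entropy_gap (P m)"
    by blast
  moreover have "entropy_gap (P j) \<le> Max (range (\<lambda>i. entropy_gap (P i)))" for j
    by (intro Max_ge) auto
  ultimately have m: "entropy_gap (P j) \<le> entropy_gap (P m)" for j
    by simp
  have "(MAX i. sqrt (entropy_gap (P i))) = sqrt (entropy_gap (P m))"
    using m by (intro Max_eqI) auto
  moreover have "ent_div1 (pauli_channel p) (pauli_channel q) = sqrt (entropy_gap (P m))"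
    unfolding ent_div1_def
  \<comment> \<open>The bound is attained, at the axis state for \<open>m\<close>, so the supremum
    is a maximum and boundedness of the set comes for free.\<close>
  proof (rule cSup_eq_maximum)
    have "(\<Sum>i\<in>UNIV. ((axis m 1 :: real^3) $ i)\<^sup>2 *\<^sub>R P i) = P m"
      using exhaust_3[of m] by (auto simp: axis_def sum_3)
    then have "QJSD (pauli_channel p (bloch_state (axis m 1))) (pauli_channel q (bloch_state (axis m 1))) = entropy_gap (P m)"
      by (simp add: QJSD)
    then show "sqrt (entropy_gap (P m)) \<in> (\<lambda>\<rho>. sqrt (QJSD (pauli_channel p \<rho>) (pauli_channel q \<rho>))) ` density_matrices"
      by (intro image_eqI[OF _ bloch_state_axis_density[of m]]) simp
  next
    fix y assume "y \<in> (\<lambda>\<rho>. sqrt (QJSD (pauli_channel p \<rho>) (pauli_channel q \<rho>))) ` density_matrices"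
    then obtain \<rho> where \<rho>: "\<rho> \<in> density_matrices" "y = sqrt (QJSD (pauli_channel p \<rho>) (pauli_channel q \<rho>))"
      by blast
    obtain r where r: "\<rho> = bloch_state r" "norm r \<le> 1"
      using density_matrix_bloch[OF \<rho>(1)] .
    have "(\<Sum>i\<in>UNIV. (r $ i)\<^sup>2) = (norm r)\<^sup>2"
      by (simp add: norm_vec3_square sum_3)
    also have "\<dots> \<le> 1" using r(2) by (simp add: power_le_one)
    finally have "entropy_gap (\<Sum>i\<in>UNIV. (r $ i)\<^sup>2 *\<^sub>R P i) \<le> entropy_gap (P m)"
      using P m by (intro entropy_gap_le_vertices) auto
    then show "y \<le> sqrt (entropy_gap (P m))"
      by (simp add: \<rho>(2) r(1) QJSD)
  qed
  ultimately show ?thesis by (simp add: gap)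
qed

end
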